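(* Let $(E,T,S,e)$ be a conditionally ergodic conditional expectation preserving system with $T$ strictly positive and $E$ $T$-universally complete, where $S$ is surjective and $(S,e)$ is aperiodic. For each $\epsilon$ with $0<\epsilon<1$ there exists a surjective Riesz homomorphism $S':E\to E$ such that $(E,T,S',e)$ is a conditional expectation preserving system with $(S',e)$ periodic and $$\sup_{u\in C_e}T|(S-S')u|\le\epsilon e.$$
   Context: $\mathbb{N}=\{1,2,\dots\}$. For an Archimedean Riesz space $E$ with weak order unit, a conditional expectation on $E$ is a positive order continuous linear projection $T:E\to E$ which maps weak order units to weak order units and whose range $R(T)$ is a Dedekind complete Riesz subspace of $E$. $T$ is strictly positive if $f\in E_+$ and $Tf=0$ imply $f=0$. A conditional expectation preserving system (CEPS) is a 4-tuple $(E,T,S,e)$ where $E$ is a Dedekind complete Riesz space, $e$ is a weak order unit of $E$, $T$ is a conditional expectation on $E$ with $Te=e$, and $S$ is an order continuous Riesz homomorphism on $E$ with $Se=e$ and $TSf=Tf$ for all $f\in E$. When $T$ is strictly positive, $S$ is injective, so if $S$ is also surjective it is bijective and $S^{-1}$ is a Riesz homomorphism. $E^u$ denotes the universal completion of $E$. $E$ is $T$-universally complete if for each upwards directed net $(f_\alpha)$ in $E_+$ such that $(Tf_\alpha)$ is order bounded in $E^u$, the net $(f_\alpha)$ is order convergent in $E$. If $E$ is $T$-universally complete, then for each $f\in E$ the order limit $L_Sf:=\lim_{n\to\infty}\frac1n\sum_{k=0}^{n-1}S^kf$ exists in $E$. The system is conditionally ergodic if $L_S=T$ (equivalently $\{f\in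 E: Sf=f\}=R(T)$). $p\in E_+$ is a component of $q\in E_+$ if $p\le q$ and $(q-p)\wedge p=0$; $C_q$ denotes the set of components of $q$. For a CEPS $(E,T,S,e)$ with $S$ bijective, a component $p$ of $e$ and $k\in\mathbb{N}$, $q(p,k)=q_S(p,k):=p\wedge (S^{-k}p)\wedge\left(e-\bigvee_{j=1}^{k-1}S^{-j}p\right)$, where the supremum of an empty family of components is $0$. For a component $v\neq0$ of $e$, $(S,v)$ is aperiodic if for each $N\in\mathbb{N}$ and each component $c\ne0$ of $v$ there exist $k\ge N$ and a component $u$ of $c$ with $q_S(u,k)\neq0$. For a component $v$ of $e$, $(S,v)$ is periodic if there is $N\in\mathbb{N}$ such that for all components $c$ of $v$ with $0\ne c\ne v$ we have $q_S(c,k)=0$ for all $k\ge N$. Periodicity of $(S',e)$ means this with $S'$ in place of $S$. *)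

theory Defs
  imports Complex_Main "HOL-Library.Lattice_Algebras" "HOL-Library.Lub_Glb"
begin

section \<open>Riesz spaces\<close>

class riesz_space = ordered_real_vector + lattice_ab_group_add_abs

class dedekind_complete_riesz_space = riesz_space + conditionally_complete_lattice

definition riesz_subspace :: "'a::riesz_space set \<Rightarrow> bool" where
  "riesz_subspace F \<longleftrightarrow> subspace F \<and> (\<forall>x\<in>F. \<forall>y\<in>F. sup x y \<in> F \<and> inf x y \<in> F)"

text \<open>Dedekind completeness of a subspace in its own order: both the upper bounds and the
  suprema are taken inside \<open>F\<close>.\<close>

definition dedekind_complete_subspace :: "'a::riesz_space set \<Rightarrow> bool" where
  "dedekind_complete_subspace F \<longleftrightarrow>
     (\<forall>A\<subseteq>F. A \<noteq> {} \<longrightarrow> (\<exists>b. isUb F A b) \<longrightarrow> (\<exists>s. isLub F A s))"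

definition riesz_homomorphism :: "('a::riesz_space \<Rightarrow> 'b::riesz_space) \<Rightarrow> bool" where
  "riesz_homomorphism h \<longleftrightarrow>
     linear h \<and> (\<forall>x y. h (sup x y) = sup (h x) (h y) \<and> h (inf x y) = inf (h x) (h y))"

definition weak_order_unit :: "'a::riesz_space \<Rightarrow> bool" where
  "weak_order_unit e \<longleftrightarrow> 0 < e \<and> (\<forall>x. inf e \<bar>x\<bar> = 0 \<longrightarrow> x = 0)"

definition riesz_components :: "'a::riesz_space \<Rightarrow> 'a set" where
  "riesz_components q = {p. 0 \<le> p \<and> p \<le> q \<and> inf (q - p) p = 0}"


section \<open>Order convergence and order continuity\<close>

definition decreases_to_zero :: "'a::dedekind_complete_riesz_space set \<Rightarrow> bool" where
  "decreases_to_zero P \<longleftrightarrow>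
     P \<noteq> {} \<and> (\<forall>p\<in>P. \<forall>q\<in>P. \<exists>r\<in>P. r \<le> p \<and> r \<le> q) \<and> (\<forall>p\<in>P. 0 \<le> p) \<and> Inf P = 0"

text \<open>Nets are represented by filters; a net corresponds to the filter generated by its tails.\<close>

definition order_converges ::
  "('i \<Rightarrow> 'a::dedekind_complete_riesz_space) \<Rightarrow> 'a \<Rightarrow> 'i filter \<Rightarrow> bool" where
  "order_converges f l F \<longleftrightarrow>
     (\<exists>P. decreases_to_zero P \<and> (\<forall>p\<in>P. eventually (\<lambda>i. \<bar>f i - l\<bar> \<le> p) F))"

text \<open>Every net in the domain yields a filter on the domain, so quantifying over these filters
  covers nets over arbitrary directed index sets.\<close>

definition order_continuous ::
  "('a::dedekind_complete_riesz_space \<Rightarrow> 'b::dedekind_complete_riesz_space) \<Rightarrow> bool" where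
  "order_continuous h \<longleftrightarrow>
     (\<forall>F l. order_converges (\<lambda>x. x) l F \<longrightarrow> order_converges h (h l) F)"

definition upwards_directed :: "'a::riesz_space set \<Rightarrow> bool" where
  "upwards_directed D \<longleftrightarrow> D \<noteq> {} \<and> (\<forall>x\<in>D. \<forall>y\<in>D. \<exists>z\<in>D. x \<le> z \<and> y \<le> z)"

text \<open>An increasing net has the same tails, up to cofinality, as its range indexed by itself.\<close>

definition upwards_filter :: "'a::riesz_space set \<Rightarrow> 'a filter" where
  "upwards_filter D = (INF d\<in>D. principal {x\<in>D. d \<le> x})"


section \<open>Conditional expectations and universal completeness\<close>

definition conditional_expectation :: "('a::dedekind_complete_riesz_space \<Rightarrow> 'a) \<Rightarrow> bool" where
  "conditional_expectation T \<longleftrightarrow>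
     linear T \<and> (\<forall>f. T (T f) = T f) \<and> (\<forall>f\<ge>0. 0 \<le> T f) \<and> order_continuous T \<and>
     (\<forall>w. weak_order_unit w \<longrightarrow> weak_order_unit (T w)) \<and>
     riesz_subspace (range T) \<and> dedekind_complete_subspace (range T)"

definition strictly_positive :: "('a::riesz_space \<Rightarrow> 'a) \<Rightarrow> bool" where
  "strictly_positive T \<longleftrightarrow> (\<forall>f\<ge>0. T f = 0 \<longrightarrow> f = 0)"

definition laterally_complete :: "'u::riesz_space itself \<Rightarrow> bool" where
  "laterally_complete _ \<longleftrightarrow>
     (\<forall>A::'u set. A \<noteq> {} \<longrightarrow> (\<forall>a\<in>A. 0 \<le> a) \<longrightarrow> (\<forall>a\<in>A. \<forall>b\<in>A. a \<noteq> b \<longrightarrow> inf a b = 0) \<longrightarrow>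
        (\<exists>s. isLub UNIV A s))"

text \<open>\<open>J\<close> realises its codomain as the universal completion of its domain: the codomain is
  universally complete (Dedekind complete by its sort, and laterally complete) and contains the
  domain, embedded by \<open>J\<close>, as an order dense Riesz subspace. Such a codomain is unique up to a
  Riesz isomorphism respecting the embeddings.\<close>

definition universal_completion ::
  "('a::riesz_space \<Rightarrow> 'u::dedekind_complete_riesz_space) \<Rightarrow> bool" where
  "universal_completion J \<longleftrightarrow>
     riesz_homomorphism J \<and> inj J \<and> (\<forall>u>0. \<exists>x. 0 < J x \<and> J x \<le> u) \<and>
     laterally_complete TYPE('u)"

definition T_universally_complete ::
  "('a::dedekind_complete_riesz_space \<Rightarrow> 'u::dedekind_complete_riesz_space) \<Rightarrow> ('a \<Rightarrow> 'a) \<Rightarrow> bool"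
  where
  "T_universally_complete J T \<longleftrightarrow>
     (\<forall>D. upwards_directed D \<longrightarrow> (\<forall>f\<in>D. 0 \<le> f) \<longrightarrow> (\<exists>a b. \<forall>f\<in>D. a \<le> J (T f) \<and> J (T f) \<le> b) \<longrightarrow>
        (\<exists>l. order_converges (\<lambda>f. f) l (upwards_filter D)))"


section \<open>Conditional expectation preserving systems\<close>

definition ceps ::
  "('a::dedekind_complete_riesz_space \<Rightarrow> 'a) \<Rightarrow> ('a \<Rightarrow> 'a) \<Rightarrow> 'a \<Rightarrow> bool" where
  "ceps T S e \<longleftrightarrow>
     weak_order_unit e \<and> conditional_expectation T \<and> T e = e \<and>
     riesz_homomorphism S \<and> order_continuous S \<and> S e = e \<and> (\<forall>f. T (S f) = T f)"

text \<open>\<open>L\<^sub>S = T\<close>, where \<open>L\<^sub>S f\<close> is the order limit of the Cesaro means of \<open>f\<close>. Order limits are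
  unique, so this says that the means of every \<open>f\<close> converge in order to \<open>T f\<close>.\<close>

definition conditionally_ergodic ::
  "('a::dedekind_complete_riesz_space \<Rightarrow> 'a) \<Rightarrow> ('a \<Rightarrow> 'a) \<Rightarrow> bool" where
  "conditionally_ergodic T S \<longleftrightarrow>
     (\<forall>f. order_converges (\<lambda>n. (1 / real n) *\<^sub>R (\<Sum>k<n. (S ^^ k) f)) (T f) sequentially)"

text \<open>Intended for bijective \<open>S\<close>, a component \<open>p\<close> of \<open>e\<close> and \<open>k \<ge> 1\<close>. Inserting \<open>0\<close> makes the
  supremum of the empty family \<open>0\<close> and does not affect the others, which consist of components.\<close>

definition first_return ::
  "'a::dedekind_complete_riesz_space \<Rightarrow> ('a \<Rightarrow> 'a) \<Rightarrow> 'a \<Rightarrow> nat \<Rightarrow> 'a" where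
  "first_return e S p k =
     inf (inf p ((inv S ^^ k) p)) (e - Sup (insert 0 ((\<lambda>j. (inv S ^^ j) p) ` {1..<k})))"

definition ceps_aperiodic ::
  "'a::dedekind_complete_riesz_space \<Rightarrow> ('a \<Rightarrow> 'a) \<Rightarrow> 'a \<Rightarrow> bool" where
  "ceps_aperiodic e S v \<longleftrightarrow>
     v \<in> riesz_components e \<and> v \<noteq> 0 \<and>
     (\<forall>N\<ge>1. \<forall>c\<in>riesz_components v. c \<noteq> 0 \<longrightarrow>
        (\<exists>k\<ge>N. \<exists>u\<in>riesz_components c. first_return e S u k \<noteq> 0))"

definition ceps_periodic ::
  "'a::dedekind_complete_riesz_space \<Rightarrow> ('a \<Rightarrow> 'a) \<Rightarrow> 'a \<Rightarrow> bool" where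
  "ceps_periodic e S v \<longleftrightarrow>
     v \<in> riesz_components e \<and>
     (\<exists>N\<ge>1. \<forall>c\<in>riesz_components v. c \<noteq> 0 \<longrightarrow> c \<noteq> v \<longrightarrow> (\<forall>k\<ge>N. first_return e S c k = 0))"

end

theory Submission
  imports Defs
begin

text \<open>There are no points here, so "last visit" and "next visit" to \<open>p\<close> are
  expressed by components: pulling back or pushing forward \<open>p\<close> and removing what
  earlier translates cover. Maximality gives a two-sided window: a nonzero remainder disjoint from
  \<open>S^j p\<close> for all |j| < N would contain a nonzero wandering component that could be
  added to \<open>p\<close>, so the 2N - 1 translates with |j| < N cover \<open>e\<close>. Shifting
  this window by powers of \<open>S\<close> gives two one-sided covers, and both are needed: the
  backward one bounds the return time to \<open>p\<close>, hence the heights of the towers, and the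
  forward one shows that every part of \<open>e\<close> lies above \<open>p\<close>. The heights
  vary, so the order of the new map is a common multiple of them rather than a single height. On a
  top level \<open>S\<close> and the new map both carry the piece away from where it was, to
  different places; the difference therefore costs two copies of \<open>T p\<close>, which is why N
  is chosen with N >= 2/\<epsilon>.\<close>

text \<open>By Zorn's lemma there is a maximal component \<open>p\<close> disjoint from \<open>S\<^sup>-\<^sup>j p\<close> for \<open>1 \<le> j < N\<close>.
  Aperiodicity and maximality force finitely many translates of \<open>p\<close> to cover \<open>e\<close>, so \<open>e\<close> splits
  into finitely many towers over \<open>p\<close> of bounded height, whereas \<open>T p \<le> e / N\<close>. Let \<open>S'\<close> move up each
  tower like \<open>S\<close> and send its top level back to its base: this permutes the levels of every tower
  cyclically, so \<open>S'\<close> has finite order, and it differs from \<open>S\<close> only on the top levels, whose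
  expectations add up to \<open>T p\<close>.\<close>

section \<open>Disjointness\<close>

definition riesz_disjoint :: "'a::riesz_space \<Rightarrow> 'a \<Rightarrow> bool" where
  "riesz_disjoint x y \<longleftrightarrow> inf \<bar>x\<bar> \<bar>y\<bar> = 0"

lemma riesz_disjoint_commute: "riesz_disjoint x y \<longleftrightarrow> riesz_disjoint y x"
  by (simp add: riesz_disjoint_def inf.commute)

lemma riesz_disjoint_sym: "riesz_disjoint x y \<Longrightarrow> riesz_disjoint y x"
  by (simp add: riesz_disjoint_commute)

lemma riesz_disjoint_0 [simp]: "riesz_disjoint 0 x" "riesz_disjoint x 0"
  by (simp_all add: riesz_disjoint_def inf_absorb1 inf_absorb2)

lemma riesz_disjoint_nonneg:
  fixes x y :: "'a::riesz_space"
  assumes "0 \<le> x" "0 \<le> y"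
  shows "riesz_disjoint x y \<longleftrightarrow> inf x y = 0"
  using assms by (simp add: riesz_disjoint_def)

lemma riesz_disjoint_mono:
  fixes x y z :: "'a::riesz_space"
  assumes "riesz_disjoint y z" "\<bar>x\<bar> \<le> \<bar>y\<bar>"
  shows "riesz_disjoint x z"
proof -
  have "inf \<bar>x\<bar> \<bar>z\<bar> \<le> inf \<bar>y\<bar> \<bar>z\<bar>" using assms(2) by (rule inf_mono) simp
  moreover have "0 \<le> inf \<bar>x\<bar> \<bar>z\<bar>" by simp
  ultimately show ?thesis using assms(1) unfolding riesz_disjoint_def by (intro antisym) simp_all
qed

lemma riesz_disjoint_mono2:
  fixes x y :: "'a::riesz_space"
  assumes "riesz_disjoint x y" "0 \<le> x'" "x' \<le> x" "0 \<le> y'" "y' \<le> y"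
  shows "riesz_disjoint x' y'"
proof -
  have nonneg: "0 \<le> x" "0 \<le> y" using assms order_trans by blast+
  have "riesz_disjoint x' y"
    using assms nonneg by (intro riesz_disjoint_mono[OF assms(1)]) simp
  then have "riesz_disjoint y x'" by (simp add: riesz_disjoint_commute)
  then have "riesz_disjoint y' x'"
    by (rule riesz_disjoint_mono) (use assms nonneg in simp)
  then show ?thesis by (simp add: riesz_disjoint_commute)
qed

text \<open>With \<open>t\<close> the left-hand side, \<open>t - inf a c\<close> is the larger of
  \<open>t - a\<close> and \<open>t - c\<close>, and so lies below both \<open>b\<close> and
  \<open>c\<close>. This is what makes disjointness from a fixed element additive.\<close>

lemma inf_add_le:
  fixes a b c :: "'a::riesz_space"
  assumes "0 \<le> a" "0 \<le> b" "0 \<le> c"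
  shows "inf (a + b) c \<le> inf a c + inf b c"
proof -
  define t where "t = inf (a + b) c"
  have t: "t \<le> a + b" "t \<le> c" by (simp_all add: t_def)
  have eq: "t - inf a c = sup (t - a) (t - c)"
    by (simp add: diff_inf_eq_sup add_sup_distrib_left)
  have "t - inf a c \<le> b"
  proof -
    have "t - a \<le> b" using t(1) by (simp add: diff_le_eq add.commute[of b])
    moreover have "t - c \<le> b" using order_trans[OF t(2), of "b + c"] assms(2) by (simp add: diff_le_eq)
    ultimately show ?thesis unfolding eq by simp
  qed
  moreover have "t - inf a c \<le> c"
    unfolding diff_le_eq using t(2) assms by (simp add: add_increasing2)
  ultimately have "t - inf a c \<le> inf b c" by (rule le_infI)
  then have "t \<le> inf b c + inf a c" by (simp only: diff_le_eq)
  then show ?thesis by (simp add: t_def add.commute)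
qed

lemma riesz_disjoint_add:
  fixes x y z :: "'a::riesz_space"
  assumes "riesz_disjoint x z" "riesz_disjoint y z"
  shows "riesz_disjoint (x + y) z"
proof -
  have "inf (\<bar>x\<bar> + \<bar>y\<bar>) \<bar>z\<bar> \<le> inf \<bar>x\<bar> \<bar>z\<bar> + inf \<bar>y\<bar> \<bar>z\<bar>" by (rule inf_add_le) simp_all
  also have "\<dots> = 0" using assms by (simp add: riesz_disjoint_def)
  finally have "inf (\<bar>x\<bar> + \<bar>y\<bar>) \<bar>z\<bar> = 0" by (rule antisym) simp
  then have "riesz_disjoint (\<bar>x\<bar> + \<bar>y\<bar>) z" by (simp add: riesz_disjoint_def)
  then show ?thesis by (rule riesz_disjoint_mono) (simp add: abs_triangle_ineq)
qed

lemma riesz_disjoint_minus: "riesz_disjoint x z \<Longrightarrow> riesz_disjoint (- x) z"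
  by (simp add: riesz_disjoint_def)

lemma riesz_disjoint_diff:
  "riesz_disjoint x z \<Longrightarrow> riesz_disjoint y z \<Longrightarrow> riesz_disjoint (x - y) z"
  using riesz_disjoint_add[of x z "- y"] riesz_disjoint_minus[of y z] by simp

lemma riesz_disjoint_sum:
  "(\<And>i. i \<in> I \<Longrightarrow> riesz_disjoint (f i) z) \<Longrightarrow> riesz_disjoint (sum f I) z"
  by (induction I rule: infinite_finite_induct) (auto intro: riesz_disjoint_add)

text \<open>Integer multiples of |x| are handled by repeated addition; a real multiple of x is
  dominated by one of them, by the Archimedean property of the reals.\<close>

lemma riesz_disjoint_scaleR:
  fixes x z :: "'a::riesz_space"
  assumes "riesz_disjoint x z"
  shows "riesz_disjoint (r *\<^sub>R x) z"
proof -
  obtain n :: nat where n: "\<bar>r\<bar> \<le> real n" using real_arch_simple by blast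
  have "riesz_disjoint (real m *\<^sub>R \<bar>x\<bar>) z" for m
  proof (induction m)
    case (Suc m)
    have "riesz_disjoint \<bar>x\<bar> z" using assms by (simp add: riesz_disjoint_def)
    from riesz_disjoint_add[OF this Suc] show ?case by (simp add: scaleR_add_left)
  qed simp
  then show ?thesis
  proof (rule riesz_disjoint_mono)
    have *: "r *\<^sub>R x \<le> real n *\<^sub>R \<bar>x\<bar>" if "\<bar>r\<bar> \<le> real n" for r
    proof -
      have "r *\<^sub>R x \<le> \<bar>r\<bar> *\<^sub>R \<bar>x\<bar>"
      proof (cases "0 \<le> r")
        case True
        then show ?thesis by (simp add: scaleR_left_mono abs_ge_self)
      next
        case False
        then have "(- r) *\<^sub>R (- x) \<le> (- r) *\<^sub>R \<bar>x\<bar>"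
          by (intro scaleR_left_mono) (simp_all add: abs_ge_minus_self)
        then show ?thesis using False by simp
      qed
      also have "\<dots> \<le> real n *\<^sub>R \<bar>x\<bar>" using that by (intro scaleR_right_mono) simp_all
      finally show ?thesis .
    qed
    have "\<bar>r *\<^sub>R x\<bar> \<le> real n *\<^sub>R \<bar>x\<bar>"
      using *[of r] *[of "- r"] n by (simp add: abs_le_iff)
    then show "\<bar>r *\<^sub>R x\<bar> \<le> \<bar>real n *\<^sub>R \<bar>x\<bar>\<bar>" by (rule order_trans) (rule abs_ge_self)
  qed
qed

text \<open>A special case of the infinite distributive law. For disjoint positive elements the sum
  is the supremum, so each \<open>a\<close> lies below \<open>sup ?s d - d\<close>; the supremum
  inherits this bound, and \<open>x + y = sup x y + inf x y\<close> turns it back into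
  disjointness.\<close>

lemma Sup_inf_eq_0:
  fixes A :: "'a::dedekind_complete_riesz_space set"
  assumes "A \<noteq> {}" "bdd_above A" "\<And>a. a \<in> A \<Longrightarrow> 0 \<le> a" "0 \<le> d"
    "\<And>a. a \<in> A \<Longrightarrow> inf a d = 0"
  shows "inf (Sup A) d = 0"
proof -
  let ?s = "Sup A"
  have "?s \<le> sup ?s d - d"
  proof (rule cSup_least[OF assms(1)])
    fix a assume a: "a \<in> A"
    have "a + d = sup a d" using assms(5)[OF a] add_eq_inf_sup[of a d] by simp
    also have "\<dots> \<le> sup ?s d" using cSup_upper[OF a assms(2)] by (intro sup_mono) simp_all
    finally show "a \<le> sup ?s d - d" by (simp add: le_diff_eq)
  qed
  then have "inf ?s d \<le> 0" using add_eq_inf_sup[of ?s d] by (simp add: le_diff_eq)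
  moreover have "0 \<le> ?s" using assms(1,2,3) by (meson cSup_upper2 ex_in_conv)
  ultimately show ?thesis using assms(4) by (intro antisym) simp_all
qed


section \<open>Order automorphisms\<close>

text \<open>Stated by order equivalence instead of lattice identities: surjectivity recovers
  \<open>inf\<close> and \<open>sup\<close>, and for \<open>cyclic\<close> it is enough that the map
  and its inverse are monotone.\<close>

definition riesz_automorphism :: "('a::riesz_space \<Rightarrow> 'a) \<Rightarrow> bool" where
  "riesz_automorphism G \<longleftrightarrow> linear G \<and> bij G \<and> (\<forall>x y. G x \<le> G y \<longleftrightarrow> x \<le> y)"

lemma riesz_automorphism_inf:
  assumes "riesz_automorphism G"
  shows "G (inf x y) = inf (G x) (G y)"
proof -
  have le: "G a \<le> G b \<longleftrightarrow> a \<le> b" for a b using assms by (simp add: riesz_automorphism_def)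
  obtain z where z: "inf (G x) (G y) = G z"
    using assms unfolding riesz_automorphism_def by (meson bij_pointE)
  have "G z \<le> G x" "G z \<le> G y" unfolding z[symmetric] by simp_all
  then have "z \<le> inf x y" by (simp add: le)
  then have "G z \<le> G (inf x y)" by (simp add: le)
  moreover have "G (inf x y) \<le> inf (G x) (G y)" by (simp add: le)
  ultimately show ?thesis using z by (simp add: antisym)
qed

lemma riesz_automorphism_linear: "riesz_automorphism G \<Longrightarrow> linear G"
  by (simp add: riesz_automorphism_def)

lemma riesz_automorphism_sup:
  assumes "riesz_automorphism G"
  shows "G (sup x y) = sup (G x) (G y)"
  using riesz_automorphism_inf[OF assms, of "- x" "- y"]
    linear_neg[OF riesz_automorphism_linear[OF assms]]
  by (metis neg_sup_eq_inf minus_minus)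

lemma riesz_automorphism_abs:
  assumes "riesz_automorphism G"
  shows "G \<bar>x\<bar> = \<bar>G x\<bar>"
  using riesz_automorphism_sup[OF assms, of x "- x"]
    linear_neg[OF riesz_automorphism_linear[OF assms]]
  by (simp add: abs_lattice)

lemma riesz_automorphism_disjoint:
  assumes "riesz_automorphism G"
  shows "riesz_disjoint (G x) (G y) \<longleftrightarrow> riesz_disjoint x y"
proof -
  have "G z = 0 \<longleftrightarrow> z = 0" for z
    using assms linear_0[OF riesz_automorphism_linear[OF assms]]
    unfolding riesz_automorphism_def by (metis bij_pointE)
  then show ?thesis
    by (simp add: riesz_disjoint_def flip: riesz_automorphism_abs[OF assms]
        riesz_automorphism_inf[OF assms])
qed

lemma riesz_automorphism_nonneg:
  assumes "riesz_automorphism G"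
  shows "0 \<le> G x \<longleftrightarrow> 0 \<le> x"
  using assms linear_0[of G] unfolding riesz_automorphism_def by metis

lemma riesz_automorphism_funpow:
  assumes "riesz_automorphism G"
  shows "riesz_automorphism (G ^^ n)"
proof -
  have "linear (G ^^ n)"
    using assms by (induction n) (auto simp: riesz_automorphism_def linear_id linear_compose)
  moreover have "(G ^^ n) x \<le> (G ^^ n) y \<longleftrightarrow> x \<le> y" for x y
    using assms by (induction n) (auto simp: riesz_automorphism_def)
  ultimately show ?thesis using assms by (auto simp: riesz_automorphism_def bij_fn)
qed

lemma riesz_automorphism_inv:
  assumes "riesz_automorphism G"
  shows "riesz_automorphism (inv G)"
proof -
  have b: "bij G" and l: "linear G" and le: "\<And>a b. G a \<le> G b \<longleftrightarrow> a \<le> b"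
    using assms by (auto simp: riesz_automorphism_def)
  have GI: "G (inv G x) = x" for x using b by (simp add: bij_is_surj surj_f_inv_f)
  have IG: "inv G (G x) = x" for x using b by (simp add: bij_is_inj inv_f_f)
  have "linear (inv G)"
  proof (rule linearI)
    show "inv G (x + y) = inv G x + inv G y" for x y
      using IG[of "inv G x + inv G y"] by (simp add: linear_add[OF l] GI)
    show "inv G (r *\<^sub>R x) = r *\<^sub>R inv G x" for r x
      using IG[of "r *\<^sub>R inv G x"] by (simp add: linear_scale[OF l] GI)
  qed
  moreover have "inv G x \<le> inv G y \<longleftrightarrow> x \<le> y" for x y
    using le[of "inv G x" "inv G y"] by (simp add: GI)
  ultimately show ?thesis using b by (simp add: riesz_automorphism_def bij_imp_bij_inv)
qed

lemma riesz_automorphism_homomorphism: "riesz_automorphism G \<Longrightarrow> riesz_homomorphism G"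
  by (simp add: riesz_homomorphism_def riesz_automorphism_linear riesz_automorphism_inf
      riesz_automorphism_sup)

lemma riesz_homomorphism_bij_automorphism:
  assumes "riesz_homomorphism h" "bij h"
  shows "riesz_automorphism h"
proof -
  have "h x \<le> h y \<longleftrightarrow> x \<le> y" for x y
  proof -
    have "h x \<le> h y \<longleftrightarrow> h (inf x y) = h x"
      using assms(1) by (simp add: riesz_homomorphism_def inf.absorb_iff1)
    also have "\<dots> \<longleftrightarrow> x \<le> y" using assms(2) by (simp add: bij_is_inj inj_eq inf.absorb_iff1)
    finally show ?thesis .
  qed
  then show ?thesis using assms by (simp add: riesz_automorphism_def riesz_homomorphism_def)
qed

lemma riesz_automorphism_Sup:
  fixes A :: "'a::dedekind_complete_riesz_space set"
  assumes G: "riesz_automorphism G" and A: "A \<noteq> {}" "bdd_above A"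
  shows "G (Sup A) = Sup (G ` A)"
proof (rule cSup_eq_non_empty[symmetric])
  have le: "G a \<le> G b \<longleftrightarrow> a \<le> b" for a b using G by (simp add: riesz_automorphism_def)
  show "G ` A \<noteq> {}" using A by simp
  show "x \<le> G (Sup A)" if "x \<in> G ` A" for x using that A by (auto simp: le intro: cSup_upper)
  fix y assume y: "\<And>x. x \<in> G ` A \<Longrightarrow> x \<le> y"
  obtain z where z: "y = G z" using G unfolding riesz_automorphism_def by (meson bij_pointE)
  have "Sup A \<le> z" using A y by (intro cSup_least) (auto simp flip: le[of _ z] z)
  then show "G (Sup A) \<le> y" by (simp add: z le)
qed

text \<open>An order isomorphism preserves existing infima, so the image of a dominating set that
  decreases to zero is again one.\<close>

lemma riesz_automorphism_order_continuous:
  fixes G :: "'a::dedekind_complete_riesz_space \<Rightarrow> 'a"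
  assumes G: "riesz_automorphism G"
  shows "order_continuous G"
  unfolding order_continuous_def
proof (intro allI impI)
  have le: "G a \<le> G b \<longleftrightarrow> a \<le> b" for a b using G by (simp add: riesz_automorphism_def)
  have G0: "G 0 = 0" and Gd: "G (x - y) = G x - G y" for x y
    using riesz_automorphism_linear[OF G] by (simp_all add: linear_0 linear_diff)
  fix F and l :: 'a assume "order_converges (\<lambda>x. x) l F"
  then obtain P where P: "decreases_to_zero P" and ev: "\<And>p. p \<in> P \<Longrightarrow> eventually (\<lambda>i. \<bar>i - l\<bar> \<le> p) F"
    by (auto simp: order_converges_def)
  have P': "P \<noteq> {}" "\<And>p q. p \<in> P \<Longrightarrow> q \<in> P \<Longrightarrow> \<exists>r\<in>P. r \<le> p \<and> r \<le> q"
      "\<And>p. p \<in> P \<Longrightarrow> 0 \<le> p" "Inf P = 0"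
    using P by (auto simp: decreases_to_zero_def)
  have "Inf (G ` P) = 0"
  proof (rule cInf_eq_non_empty)
    show "G ` P \<noteq> {}" using P' by simp
    show "0 \<le> x" if "x \<in> G ` P" for x
      using that P'(3) by (auto simp: riesz_automorphism_nonneg[OF G])
    fix y assume y: "\<And>x. x \<in> G ` P \<Longrightarrow> y \<le> x"
    obtain z where z: "y = G z" using G unfolding riesz_automorphism_def by (meson bij_pointE)
    have "z \<le> Inf P" using P'(1) y by (intro cInf_greatest) (auto simp flip: le[of z] z)
    then have "G z \<le> G 0" by (simp add: P'(4) le)
    then show "y \<le> 0" by (simp add: z G0)
  qed
  then have "decreases_to_zero (G ` P)"
    using P' by (auto simp: decreases_to_zero_def le riesz_automorphism_nonneg[OF G])
  moreover have "eventually (\<lambda>i. \<bar>G i - G l\<bar> \<le> p) F" if "p \<in> G ` P" for p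
    using that ev by (auto simp: le simp flip: Gd riesz_automorphism_abs[OF G])
  ultimately show "order_converges G (G l) F" by (auto simp: order_converges_def)
qed


section \<open>Components and band projections\<close>

locale weak_unit =
  fixes e :: "'a::dedekind_complete_riesz_space"
  assumes weak_unit: "weak_order_unit e"
begin

lemma unit_nonneg: "0 \<le> e"
  using weak_unit by (simp add: weak_order_unit_def less_imp_le)

lemma disjoint_unit:
  assumes "riesz_disjoint x e"
  shows "x = 0"
proof -
  have "inf e \<bar>x\<bar> = 0"
    using assms unit_nonneg by (simp add: riesz_disjoint_def inf.commute)
  then show ?thesis using weak_unit unfolding weak_order_unit_def by blast
qed

abbreviation \<C> :: "'a set" where "\<C> \<equiv> riesz_components e"

lemma component_iff: "c \<in> \<C> \<longleftrightarrow> 0 \<le> c \<and> c \<le> e \<and> riesz_disjoint c (e - c)"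
  by (auto simp: riesz_components_def riesz_disjoint_nonneg inf.commute)

lemma component_nonneg: "c \<in> \<C> \<Longrightarrow> 0 \<le> c"
  and component_le: "c \<in> \<C> \<Longrightarrow> c \<le> e"
  and component_disjoint: "c \<in> \<C> \<Longrightarrow> riesz_disjoint c (e - c)"
  by (simp_all add: component_iff)

lemma component_0: "0 \<in> \<C>" and component_unit: "e \<in> \<C>"
  using unit_nonneg by (simp_all add: component_iff)

lemma component_compl: "c \<in> \<C> \<Longrightarrow> e - c \<in> \<C>"
  by (simp add: component_iff riesz_disjoint_commute)

text \<open>The complement \<open>sup (e - x) (e - y)\<close> lies below the sum of two elements
  that are each disjoint from \<open>inf x y\<close>.\<close>

lemma component_inf:
  assumes "x \<in> \<C>" "y \<in> \<C>"
  shows "inf x y \<in> \<C>"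
proof -
  note xy = assms[THEN component_nonneg] assms[THEN component_le]
  have le: "e - inf x y \<le> (e - x) + (e - y)"
  proof -
    have "e - inf x y = sup (e - x) (e - y)"
      by (simp add: diff_inf_eq_sup add_sup_distrib_left)
    also have "\<dots> \<le> (e - x) + (e - y)" using xy by (simp add: add_increasing add_increasing2)
    finally show ?thesis .
  qed
  have le_unit: "inf x y \<le> e" using xy(3) by (rule le_infI1)
  have "riesz_disjoint (e - x) (inf x y)"
    by (rule riesz_disjoint_mono2[OF component_disjoint[OF assms(1), THEN riesz_disjoint_sym]])
      (use xy in simp_all)
  moreover have "riesz_disjoint (e - y) (inf x y)"
    by (rule riesz_disjoint_mono2[OF component_disjoint[OF assms(2), THEN riesz_disjoint_sym]])
      (use xy in simp_all)
  ultimately have "riesz_disjoint ((e - x) + (e - y)) (inf x y)" by (rule riesz_disjoint_add)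
  then have "riesz_disjoint (e - inf x y) (inf x y)"
    by (rule riesz_disjoint_mono2) (use le xy le_unit in \<open>simp_all del: diff_inf_eq_sup\<close>)
  then have "riesz_disjoint (inf x y) (e - inf x y)" by (rule riesz_disjoint_sym)
  then show ?thesis using xy le_unit by (simp add: component_iff)
qed

lemma compl_sup: "e - sup x y = inf (e - x) (e - y)"
  by (simp add: diff_sup_eq_inf add_inf_distrib_left)

lemma component_sup:
  assumes "x \<in> \<C>" "y \<in> \<C>"
  shows "sup x y \<in> \<C>"
  using component_compl[OF component_inf[OF assms[THEN component_compl]]]
  by (simp flip: compl_sup)

lemma component_trans:
  assumes c: "c \<in> \<C>" and u: "u \<in> riesz_components c"
  shows "u \<in> \<C>"
proof -
  have u': "0 \<le> u" "u \<le> c" "riesz_disjoint (c - u) u"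
    using u by (auto simp: riesz_components_def riesz_disjoint_nonneg)
  have "riesz_disjoint (e - c) u"
    by (rule riesz_disjoint_mono2[OF component_disjoint[OF c, THEN riesz_disjoint_sym]])
      (use u' component_le[OF c] in simp_all)
  from riesz_disjoint_add[OF this u'(3)] have "riesz_disjoint u (e - u)"
    by (simp add: riesz_disjoint_commute)
  then show ?thesis using u' component_le[OF c] by (simp add: component_iff)
qed

text \<open>A component \<open>x\<close> splits \<open>y\<close> into its parts below
  \<open>x\<close> and below \<open>e - x\<close>; only the second adds anything to
  \<open>x\<close>. This is the induction step that turns finite suprema into disjoint sums.\<close>

lemma sup_component_eq:
  assumes x: "x \<in> \<C>" and y: "0 \<le> y" "y \<le> e"
  shows "sup x y = x + inf y (e - x)"
proof -
  have d: "inf x (e - x) = 0"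
    using component_disjoint[OF x] component_nonneg[OF x] component_le[OF x]
    by (simp add: riesz_disjoint_nonneg)
  have "y = inf e y" using y(2) by (rule inf_absorb2[symmetric])
  also have "\<dots> = inf ((e - x) + x) y" by simp
  also have "\<dots> \<le> inf (e - x) y + inf x y"
    using x y by (intro inf_add_le) (simp_all add: component_iff)
  finally have 1: "y \<le> inf (e - x) y + inf x y" .
  have "inf (inf (e - x) y) (inf x y) = inf (inf x (e - x)) y" by (simp add: ac_simps)
  also have "\<dots> = 0" using y by (simp add: d inf_absorb1)
  finally have "inf (inf (e - x) y) (inf x y) = 0" .
  then have "inf (e - x) y + inf x y = sup (inf (e - x) y) (inf x y)"
    using add_eq_inf_sup by (metis add.right_neutral)
  also have "\<dots> \<le> y" by simp
  finally have "y = inf (e - x) y + inf x y" using 1 by (rule antisym[rotated])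
  then have eq: "x + y = x + (inf (e - x) y + inf x y)" by (rule arg_cong)
  have "sup x y + inf x y = x + y" by (rule add_eq_inf_sup[symmetric])
  also note eq
  finally show ?thesis by (simp add: inf.commute[of y] add.assoc[symmetric])
qed

lemma add_component:
  assumes "x \<in> \<C>" "y \<in> \<C>" "riesz_disjoint x y"
  shows "x + y \<in> \<C>"
proof -
  have "inf x y = 0"
    using assms by (simp add: riesz_disjoint_nonneg component_nonneg)
  then have "x + y = sup x y" using add_eq_inf_sup[of x y] by simp
  then show ?thesis using component_sup[OF assms(1,2)] by simp
qed

lemma component_Sup:
  assumes A: "A \<noteq> {}" "A \<subseteq> \<C>"
  shows "Sup A \<in> \<C>"
proof -
  have b: "bdd_above A" using A(2) component_le by (meson bdd_aboveI subsetD)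
  have nn: "0 \<le> Sup A" using A b component_nonneg by (meson cSup_upper2 ex_in_conv subsetD)
  have le: "Sup A \<le> e" using A component_le by (meson cSup_least subsetD)
  have "inf (Sup A) (e - Sup A) = 0"
  proof (rule Sup_inf_eq_0[OF A(1) b])
    show "0 \<le> e - Sup A" using le by simp
    show "0 \<le> a" if "a \<in> A" for a using that A(2) component_nonneg by auto
    show "inf a (e - Sup A) = 0" if a: "a \<in> A" for a
    proof -
      have "a \<in> \<C>" using a A(2) by auto
      then have "riesz_disjoint a (e - Sup A)"
        using a b le by (intro riesz_disjoint_mono2[OF component_disjoint[of a]])
          (auto simp: cSup_upper component_nonneg)
      then show ?thesis using le \<open>a \<in> \<C>\<close> by (simp add: riesz_disjoint_nonneg component_nonneg)
    qed
  qed
  then show ?thesis using nn le by (simp add: component_iff riesz_disjoint_nonneg)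
qed

lemma component_automorphism:
  assumes G: "riesz_automorphism G" and Ge: "G e = e" and c: "c \<in> \<C>"
  shows "G c \<in> \<C>"
proof -
  have "G c \<le> G e" using G component_le[OF c] by (simp add: riesz_automorphism_def)
  moreover have "riesz_disjoint (G c) (G (e - c))"
    using component_disjoint[OF c] by (simp add: riesz_automorphism_disjoint[OF G])
  ultimately show ?thesis
    using component_nonneg[OF c] linear_diff[OF riesz_automorphism_linear[OF G], of e c]
    by (simp add: component_iff riesz_automorphism_nonneg[OF G] Ge)
qed

section \<open>Band projections onto components\<close>

text \<open>The projection onto the band generated by \<open>c\<close>, characterised by
  disjointness alone. Elements of the space need not be dominated by a multiple of \<open>e\<close>,
  so \<open>inf c f\<close> would not serve for general \<open>f\<close>; below \<open>e\<close> the
  two agree.\<close>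

definition band_proj :: "'a \<Rightarrow> 'a \<Rightarrow> 'a" where
  "band_proj c f = (THE g. riesz_disjoint g (e - c) \<and> riesz_disjoint (f - g) c)"

text \<open>The difference of two candidates is disjoint from \<open>c\<close> and from
  \<open>e - c\<close>, hence from the weak unit \<open>e\<close>.\<close>

lemma band_proj_unique:
  assumes "riesz_disjoint g (e - c)" "riesz_disjoint (f - g) c"
    and "riesz_disjoint h (e - c)" "riesz_disjoint (f - h) c"
  shows "g = h"
proof -
  have "riesz_disjoint (g - h) (e - c)" using assms by (intro riesz_disjoint_diff)
  moreover have "riesz_disjoint (g - h) c"
    using riesz_disjoint_diff[OF assms(4,2)] by simp
  ultimately have "riesz_disjoint ((e - c) + c) (g - h)"
    by (intro riesz_disjoint_add) (simp_all add: riesz_disjoint_commute)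
  then show ?thesis using disjoint_unit[of "g - h"] by (simp add: riesz_disjoint_commute)
qed

lemma band_projI:
  assumes "riesz_disjoint g (e - c)" "riesz_disjoint (f - g) c"
  shows "band_proj c f = g"
  unfolding band_proj_def using assms band_proj_unique by blast

text \<open>The part of \<open>f\<close> in the band is the largest element of [0, f] disjoint from
  \<open>e - c\<close>. If the rest still met \<open>c\<close>, the overlap \<open>h\<close> could
  be added to it.\<close>

lemma band_decomposition_nonneg:
  assumes c: "c \<in> \<C>" and f: "0 \<le> f"
  shows "\<exists>g. 0 \<le> g \<and> g \<le> f \<and> riesz_disjoint g (e - c) \<and> riesz_disjoint (f - g) c"
proof -
  define A where "A = {g. 0 \<le> g \<and> g \<le> f \<and> riesz_disjoint g (e - c)}"
  have c': "0 \<le> c" "0 \<le> e - c" using c by (simp_all add: component_iff)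
  have A0: "0 \<in> A" using f by (simp add: A_def)
  have b: "bdd_above A" by (auto simp: A_def)
  have nn: "0 \<le> Sup A" using A0 b by (rule cSup_upper)
  have le: "Sup A \<le> f" using A0 by (intro cSup_least) (auto simp: A_def)
  have "inf (Sup A) (e - c) = 0"
  proof (rule Sup_inf_eq_0[OF _ b])
    show "A \<noteq> {}" using A0 by blast
  qed (use c' in \<open>auto simp: A_def riesz_disjoint_nonneg\<close>)
  then have d: "riesz_disjoint (Sup A) (e - c)" using nn c' by (simp add: riesz_disjoint_nonneg)
  define h where "h = inf (f - Sup A) c"
  have h: "0 \<le> h" "h \<le> f - Sup A" "h \<le> c" using le c' by (simp_all add: h_def)
  have "riesz_disjoint h (e - c)"
    by (rule riesz_disjoint_mono2[OF component_disjoint[OF c]]) (use h c' in simp_all)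
  then have "Sup A + h \<in> A"
    using nn h(1,2) riesz_disjoint_add[OF d] unfolding A_def le_diff_eq
    by (simp add: add.commute[of h])
  then have "Sup A + h \<le> Sup A" using b by (rule cSup_upper)
  then have "h = 0" using h(1) by (simp add: antisym)
  then have "riesz_disjoint (f - Sup A) c"
    using le c' by (simp add: riesz_disjoint_nonneg h_def)
  then show ?thesis using nn le d by blast
qed

lemma band_proj_bounds:
  assumes "c \<in> \<C>" "0 \<le> f"
  shows "0 \<le> band_proj c f" "band_proj c f \<le> f"
  using band_decomposition_nonneg[OF assms] band_projI by auto

lemma band_proj_disjoint:
  assumes c: "c \<in> \<C>"
  shows "riesz_disjoint (band_proj c f) (e - c)" "riesz_disjoint (f - band_proj c f) c"
proof -
  obtain g where g: "riesz_disjoint g (e - c)" "riesz_disjoint (pprt f - g) c"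
    using band_decomposition_nonneg[OF c, of "pprt f"] by auto
  obtain h where h: "riesz_disjoint h (e - c)" "riesz_disjoint (- nprt f - h) c"
    using band_decomposition_nonneg[OF c, of "- nprt f"] by auto
  have "f - (g - h) = (pprt f + nprt f) - (g - h)" using prts[of f] by simp
  also have "\<dots> = (pprt f - g) - (- nprt f - h)" by (simp add: algebra_simps)
  finally have "riesz_disjoint (f - (g - h)) c" using riesz_disjoint_diff[OF g(2) h(2)] by (simp only:)
  moreover have "riesz_disjoint (g - h) (e - c)" using g(1) h(1) by (rule riesz_disjoint_diff)
  ultimately show "riesz_disjoint (band_proj c f) (e - c)" "riesz_disjoint (f - band_proj c f) c"
    using band_projI by metis+
qed

lemma linear_band_proj:
  assumes c: "c \<in> \<C>"
  shows "linear (band_proj c)"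
proof (rule linearI)
  note d = band_proj_disjoint[OF c]
  fix f g r
  show "band_proj c (f + g) = band_proj c f + band_proj c g"
  proof (rule band_projI)
    show "riesz_disjoint (band_proj c f + band_proj c g) (e - c)"
      by (intro riesz_disjoint_add d)
    show "riesz_disjoint (f + g - (band_proj c f + band_proj c g)) c"
      using riesz_disjoint_add[OF d(2) d(2)] by (simp add: algebra_simps)
  qed
  show "band_proj c (r *\<^sub>R f) = r *\<^sub>R band_proj c f"
  proof (rule band_projI)
    show "riesz_disjoint (r *\<^sub>R band_proj c f) (e - c)"
      by (intro riesz_disjoint_scaleR d)
    show "riesz_disjoint (r *\<^sub>R f - r *\<^sub>R band_proj c f) c"
      using riesz_disjoint_scaleR[OF d(2)] by (simp add: algebra_simps)
  qed
qed

lemma band_proj_le_unit: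
  assumes "c \<in> \<C>" "0 \<le> x" "x \<le> e"
  shows "band_proj c x = inf c x"
proof (rule band_projI)
  have c: "0 \<le> c" "c \<le> e" "riesz_disjoint c (e - c)" using assms by (simp_all add: component_iff)
  show "riesz_disjoint (inf c x) (e - c)"
    using c assms by (intro riesz_disjoint_mono2[OF c(3)]) simp_all
  have "x - inf c x = sup (x - c) 0" by (simp add: diff_inf_eq_sup add_sup_distrib_left)
  also have "\<dots> \<le> e - c" using c assms by (simp add: diff_right_mono)
  finally have "x - inf c x \<le> e - c" .
  then show "riesz_disjoint (x - inf c x) c"
    by (intro riesz_disjoint_mono2[OF c(3)[THEN riesz_disjoint_sym]])
      (use c assms in \<open>simp_all del: diff_inf_eq_sup\<close>)
qed

lemma band_proj_idem:
  assumes "c \<in> \<C>"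
  shows "band_proj c (band_proj c f) = band_proj c f"
  using band_proj_disjoint[OF assms] by (intro band_projI) simp_all

lemma band_proj_disjoint_right:
  assumes c: "c \<in> \<C>" and d: "d \<in> \<C>" "riesz_disjoint c d"
  shows "riesz_disjoint (band_proj c f) d"
proof -
  have "inf c d = 0" using c d by (simp add: riesz_disjoint_nonneg component_nonneg)
  then have "c + d = sup c d" using add_eq_inf_sup[of c d] by simp
  also have "\<dots> \<le> e" using c d by (simp add: component_le)
  finally have "d \<le> e - c" by (simp add: le_diff_eq add.commute)
  then have "\<bar>d\<bar> \<le> \<bar>e - c\<bar>" using component_nonneg[OF d(1)] component_le[OF c] by simp
  with band_proj_disjoint(1)[OF c, of f, THEN riesz_disjoint_sym]
  have "riesz_disjoint d (band_proj c f)" by (rule riesz_disjoint_mono)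
  then show ?thesis by (rule riesz_disjoint_sym)
qed

lemma band_proj_band_proj_disjoint:
  assumes "c \<in> \<C>" "d \<in> \<C>" "riesz_disjoint c d"
  shows "band_proj c (band_proj d f) = 0"
proof (rule band_projI)
  have "riesz_disjoint d c" using assms(3) by (rule riesz_disjoint_sym)
  then show "riesz_disjoint (band_proj d f - 0) c"
    using assms(1,2) by (simp add: band_proj_disjoint_right)
qed simp

text \<open>The remainder \<open>f - ?g\<close> is disjoint from every \<open>c i\<close>, hence
  from their sum \<open>e\<close>.\<close>

lemma sum_band_proj:
  assumes I: "finite I" and c: "\<And>i. i \<in> I \<Longrightarrow> c i \<in> \<C>"
    and d: "\<And>i j. i \<in> I \<Longrightarrow> j \<in> I \<Longrightarrow> i \<noteq> j \<Longrightarrow> riesz_disjoint (c i) (c j)"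
    and e: "(\<Sum>i\<in>I. c i) = e"
  shows "(\<Sum>i\<in>I. band_proj (c i) f) = f"
proof -
  let ?g = "\<Sum>i\<in>I. band_proj (c i) f"
  have "riesz_disjoint (c i) (f - ?g)" if i: "i \<in> I" for i
  proof -
    have "f - ?g = (f - band_proj (c i) f) - (\<Sum>j\<in>I - {i}. band_proj (c j) f)"
      using sum.remove[OF I i, of "\<lambda>j. band_proj (c j) f"] by (simp add: algebra_simps)
    moreover have "riesz_disjoint (\<Sum>j\<in>I - {i}. band_proj (c j) f) (c i)"
      using i by (intro riesz_disjoint_sum band_proj_disjoint_right c d) auto
    ultimately have "riesz_disjoint (f - ?g) (c i)"
      using riesz_disjoint_diff[OF band_proj_disjoint(2)[OF c[OF i]]] by (simp only:)
    then show ?thesis by (rule riesz_disjoint_sym)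
  qed
  then have "riesz_disjoint (\<Sum>i\<in>I. c i) (f - ?g)" by (rule riesz_disjoint_sum)
  then have "f - ?g = 0" using e by (intro disjoint_unit) (simp add: riesz_disjoint_commute)
  then show ?thesis by simp
qed

lemma band_proj_automorphism:
  assumes G: "riesz_automorphism G" and Ge: "G e = e" and c: "c \<in> \<C>"
  shows "G (band_proj c f) = band_proj (G c) (G f)"
proof (rule band_projI[symmetric])
  note diff = linear_diff[OF riesz_automorphism_linear[OF G]]
  show "riesz_disjoint (G (band_proj c f)) (e - G c)"
    using band_proj_disjoint(1)[OF c, of f] diff[of e c]
    by (metis riesz_automorphism_disjoint[OF G] Ge)
  show "riesz_disjoint (G f - G (band_proj c f)) (G c)"
    using band_proj_disjoint(2)[OF c, of f] diff[of f "band_proj c f"]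
    by (metis riesz_automorphism_disjoint[OF G])
qed


section \<open>Disjointification\<close>

primrec partial_sup :: "(nat \<Rightarrow> 'a) \<Rightarrow> nat \<Rightarrow> 'a" where
  "partial_sup f 0 = 0"
| "partial_sup f (Suc n) = sup (partial_sup f n) (f n)"

definition fresh_part :: "(nat \<Rightarrow> 'a) \<Rightarrow> nat \<Rightarrow> 'a" where
  "fresh_part f n = inf (f n) (e - partial_sup f n)"

lemma partial_sup_upper: "i < n \<Longrightarrow> f i \<le> partial_sup f n"
  by (induction n) (auto simp: less_Suc_eq intro: le_supI1)

lemma partial_sup_mono: "m \<le> n \<Longrightarrow> partial_sup f m \<le> partial_sup f n"
  by (induction n) (auto simp: le_Suc_eq intro: le_supI1)

lemma partial_sup_least: "0 \<le> x \<Longrightarrow> (\<And>i. i < n \<Longrightarrow> f i \<le> x) \<Longrightarrow> partial_sup f n \<le> x"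
  by (induction n) auto

lemma partial_sup_automorphism:
  assumes "riesz_automorphism G"
  shows "G (partial_sup f n) = partial_sup (\<lambda>i. G (f i)) n"
  using assms linear_0[OF riesz_automorphism_linear[OF assms]]
  by (induction n) (simp_all add: riesz_automorphism_sup)

lemma component_partial_sup: "(\<And>i. f i \<in> \<C>) \<Longrightarrow> partial_sup f n \<in> \<C>"
  by (induction n) (auto simp: component_0 component_sup)

lemma component_fresh_part: "(\<And>i. f i \<in> \<C>) \<Longrightarrow> fresh_part f n \<in> \<C>"
  by (simp add: fresh_part_def component_inf component_compl component_partial_sup)

lemma sum_fresh_part:
  assumes "\<And>i. f i \<in> \<C>"
  shows "(\<Sum>i<n. fresh_part f i) = partial_sup f n"
proof (induction n)
  case (Suc n)
  then show ?case
    using sup_component_eq[OF component_partial_sup[OF assms]] assms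
    by (simp add: fresh_part_def component_iff)
qed simp

lemma fresh_part_disjoint:
  assumes f: "\<And>i. f i \<in> \<C>" and "i \<noteq> j"
  shows "riesz_disjoint (fresh_part f i) (fresh_part f j)"
proof -
  have *: "riesz_disjoint (fresh_part f i) (fresh_part f j)" if "i < j" for i j
  proof (rule riesz_disjoint_mono2)
    show "riesz_disjoint (f i) (e - f i)" using f by (rule component_disjoint)
    show "0 \<le> fresh_part f i" "0 \<le> fresh_part f j"
      using component_fresh_part[OF f] component_nonneg by auto
    show "fresh_part f i \<le> f i" by (simp add: fresh_part_def)
    show "fresh_part f j \<le> e - f i"
      unfolding fresh_part_def
      by (rule le_infI2) (use partial_sup_upper[OF that, of f] in \<open>simp add: diff_left_mono\<close>)
  qed
  show ?thesis
  proof (cases "i < j")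
    case False
    then show ?thesis using *[of j i] assms(2) by (simp add: riesz_disjoint_commute)
  qed (rule *)
qed

end


section \<open>A maximal wandering component\<close>

lemma linear_funpow: "linear G \<Longrightarrow> linear (G ^^ n)" for G :: "'a::real_vector \<Rightarrow> 'a"
  by (induction n) (auto simp: linear_id linear_compose)

text \<open>The setting in which the towers are built. That \<open>S\<close> is an automorphism
  comes from strict positivity and surjectivity, in \<open>ceps_automorphism\<close>.\<close>

locale preserved_expectation = weak_unit e for e :: "'a::dedekind_complete_riesz_space" +
  fixes T S :: "'a \<Rightarrow> 'a"
  assumes linear_T: "linear T"
    and T_nonneg: "\<And>f. 0 \<le> f \<Longrightarrow> 0 \<le> T f"
    and T_unit: "T e = e"
    and automorphism: "riesz_automorphism S"
    and S_unit: "S e = e"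
    and T_S: "\<And>f. T (S f) = T f"
begin

abbreviation R :: "'a \<Rightarrow> 'a" where "R \<equiv> inv S"

lemma bij_S: "bij S"
  using automorphism by (simp add: riesz_automorphism_def)

lemma S_R [simp]: "S (R x) = x" and R_S [simp]: "R (S x) = x"
  using bij_S by (simp_all add: bij_is_surj surj_f_inv_f bij_is_inj)

lemma R_unit: "R e = e"
  using R_S[of e] by (simp add: S_unit)

lemma funpow_unit: "(S ^^ n) e = e" "(R ^^ n) e = e"
  by (induction n) (simp_all add: S_unit R_unit)

lemma automorphism_pow: "riesz_automorphism (S ^^ n)" "riesz_automorphism (R ^^ n)"
  using automorphism by (simp_all add: riesz_automorphism_funpow riesz_automorphism_inv)

lemmas linear_pow = automorphism_pow[THEN riesz_automorphism_linear]

lemma component_pow: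
  assumes "c \<in> \<C>"
  shows "(S ^^ n) c \<in> \<C>" "(R ^^ n) c \<in> \<C>"
  using assms by (simp_all add: component_automorphism automorphism_pow funpow_unit)

lemma S_pow_R_pow [simp]: "(S ^^ n) ((R ^^ n) x) = x" and R_pow_S_pow [simp]: "(R ^^ n) ((S ^^ n) x) = x"
  using fn_o_inv_fn_is_id[OF bij_S, of n] inv_fn_o_fn_is_id[OF bij_S, of n]
  by (simp_all add: fun_eq_iff)

lemma R_pow_S_pow_le: "m \<le> n \<Longrightarrow> (R ^^ m) ((S ^^ n) x) = (S ^^ (n - m)) x"
  using funpow_add[of m "n - m" S] by simp

lemma R_pow_S_pow_ge: "n \<le> m \<Longrightarrow> (R ^^ m) ((S ^^ n) x) = (R ^^ (m - n)) x"
  using funpow_add[of "m - n" n R] by simp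

lemma S_pow_R_pow_ge: "n \<le> m \<Longrightarrow> (S ^^ m) ((R ^^ n) x) = (S ^^ (m - n)) x"
  using funpow_add[of "m - n" n S] by simp

lemma S_pow_R_pow_le: "m \<le> n \<Longrightarrow> (S ^^ m) ((R ^^ n) x) = (R ^^ (n - m)) x"
  using funpow_add[of m "n - m" R] by simp

lemma T_S_pow: "T ((S ^^ n) f) = T f"
  by (induction n) (simp_all add: T_S)

lemma T_R_pow: "T ((R ^^ n) f) = T f"
  using T_S_pow[of n "(R ^^ n) f"] by simp

lemma T_mono: "f \<le> g \<Longrightarrow> T f \<le> T g"
  using T_nonneg[of "g - f"] by (simp add: linear_diff[OF linear_T])

section \<open>Wandering components and the cover of the unit\<close>

definition wandering :: "nat \<Rightarrow> 'a \<Rightarrow> bool" where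
  "wandering N p \<longleftrightarrow> (\<forall>j\<in>{1..<N}. riesz_disjoint p ((R ^^ j) p))"

text \<open>Two members of the chain lie below a common member, so even mixed pairs \<open>a\<close>
  and \<open>(R ^^ j) b\<close> are disjoint. \<open>Sup_inf_eq_0\<close> then passes to the
  supremum in one argument at a time.\<close>

lemma wandering_Sup:
  assumes A: "A \<noteq> {}" "A \<subseteq> \<C>" "\<And>a b. a \<in> A \<Longrightarrow> b \<in> A \<Longrightarrow> a \<le> b \<or> b \<le> a"
    and w: "\<And>a. a \<in> A \<Longrightarrow> wandering N a"
  shows "wandering N (Sup A)"
  unfolding wandering_def
proof
  fix j assume j: "j \<in> {1..<N}"
  note G = automorphism_pow(2)[of j]
  have b: "bdd_above A" using A(2) component_le by (meson bdd_aboveI subsetD)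
  have nn: "0 \<le> a" "0 \<le> (R ^^ j) a" if "a \<in> A" for a
    using that A(2) component_nonneg by (auto simp: riesz_automorphism_nonneg[OF G])
  have nns: "0 \<le> Sup A" using component_Sup[OF A(1,2)] by (rule component_nonneg)
  have le: "(R ^^ j) a \<le> (R ^^ j) b \<longleftrightarrow> a \<le> b" for a b
    using G by (simp add: riesz_automorphism_def)
  have inf0: "inf a ((R ^^ j) b) = 0" if ab: "a \<in> A" "b \<in> A" for a b
  proof -
    obtain c where c: "c \<in> A" "a \<le> c" "b \<le> c" using A(3)[OF ab] ab by blast
    have "riesz_disjoint c ((R ^^ j) c)" using w[OF c(1)] j by (simp add: wandering_def)
    then have "riesz_disjoint a ((R ^^ j) b)"
    proof (rule riesz_disjoint_mono2)
      show "(R ^^ j) b \<le> (R ^^ j) c" using c(3) unfolding le .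
    qed (use c(2) nn ab in blast)+
    then show ?thesis using nn ab by (simp add: riesz_disjoint_nonneg)
  qed
  have "inf (Sup A) ((R ^^ j) b) = 0" if "b \<in> A" for b
    using that nn inf0 by (intro Sup_inf_eq_0[OF A(1) b]) auto
  then have *: "inf x (Sup A) = 0" if "x \<in> (R ^^ j) ` A" for x
    using that by (auto simp: inf.commute)
  have "inf (Sup ((R ^^ j) ` A)) (Sup A) = 0"
  proof (rule Sup_inf_eq_0)
    show "bdd_above ((R ^^ j) ` A)"
      using b unfolding bdd_above_def by (metis imageE le)
  qed (use A nn nns * in auto)
  then have "riesz_disjoint ((R ^^ j) (Sup A)) (Sup A)"
    using nns riesz_automorphism_nonneg[OF G, of "Sup A"]
    by (simp add: riesz_disjoint_nonneg riesz_automorphism_Sup[OF G A(1) b])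
  then show "riesz_disjoint (Sup A) ((R ^^ j) (Sup A))" by (rule riesz_disjoint_sym)
qed

lemma ex_maximal_wandering:
  "\<exists>p\<in>\<C>. wandering N p \<and> (\<forall>q\<in>\<C>. wandering N q \<longrightarrow> p \<le> q \<longrightarrow> q = p)"
proof -
  let ?D = "{p \<in> \<C>. wandering N p}"
  have "\<exists>m\<in>?D. \<forall>a\<in>?D. m \<le> a \<longrightarrow> a = m"
  proof (rule predicate_Zorn)
    show "partial_order_on ?D (relation_of (\<le>) ?D)"
      by (rule partial_order_on_relation_ofI) auto
    fix A assume "A \<in> Chains (relation_of (\<le>) ?D)"
    then have A: "A \<subseteq> ?D" "\<And>a b. a \<in> A \<Longrightarrow> b \<in> A \<Longrightarrow> a \<le> b \<or> b \<le> a"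
      by (auto simp: Chains_def relation_of_def)
    show "\<exists>u\<in>?D. \<forall>a\<in>A. a \<le> u"
    \<comment> \<open>The empty chain also needs an upper bound, and \<open>Sup {}\<close> carries
      no information in a conditionally complete lattice; \<open>0\<close> is wandering.\<close>
    proof (cases "A = {}")
      case True
      have "0 \<in> ?D"
        by (auto simp: component_0 wandering_def)
      then show ?thesis using True by blast
    next
      case False
      have AC: "A \<subseteq> \<C>" using A by auto
      then have b: "bdd_above A" using component_le by (meson bdd_aboveI subsetD)
      have "Sup A \<in> ?D"
        using component_Sup[OF False AC] wandering_Sup[OF False AC A(2)] A(1) by auto
      then show ?thesis using cSup_upper[OF _ b] by blast
    qed
  qed
  then show ?thesis by blast
qed

text \<open>This is where aperiodicity acts: for \<open>k\<close> >= N the nonzero first-return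
  component \<open>w\<close> of \<open>u\<close> is itself wandering. It avoids
  \<open>(R ^^ j) u\<close> for 1 <= j < k, while \<open>(R ^^ j) w\<close> lies inside
  \<open>(R ^^ j) u\<close>.\<close>

lemma ex_wandering_below:
  assumes ap: "ceps_aperiodic e S e" and N: "1 \<le> N" and c: "c \<in> \<C>" "c \<noteq> 0"
  shows "\<exists>w\<in>\<C>. w \<le> c \<and> w \<noteq> 0 \<and> wandering N w"
proof -
  obtain k u where k: "N \<le> k" and u: "u \<in> riesz_components c" and q: "first_return e S u k \<noteq> 0"
    using ap N c unfolding ceps_aperiodic_def by meson
  define A where "A = insert 0 ((\<lambda>j. (R ^^ j) u) ` {1..<k})"
  define w where "w = first_return e S u k"
  have w_eq: "w = inf (inf u ((R ^^ k) u)) (e - Sup A)"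
    by (simp add: w_def first_return_def A_def)
  have uC: "u \<in> \<C>" using component_trans[OF c(1) u] .
  have A: "A \<noteq> {}" "A \<subseteq> \<C>" using component_pow(2)[OF uC] component_0 by (auto simp: A_def)
  then have b: "bdd_above A" using component_le by (meson bdd_aboveI subsetD)
  have wC: "w \<in> \<C>"
    unfolding w_eq by (intro component_inf component_compl component_pow uC component_Sup A)
  have wu: "w \<le> u" by (simp add: w_eq le_infI1)
  have "wandering N w"
    unfolding wandering_def
  proof
    fix j assume j: "j \<in> {1..<N}"
    have jA: "(R ^^ j) u \<in> A" using j k by (auto simp: A_def)
    have "w \<le> e - Sup A" by (simp add: w_eq)
    also have "\<dots> \<le> e - (R ^^ j) u" using cSup_upper[OF jA b] by (simp add: diff_left_mono)
    finally have "w \<le> e - (R ^^ j) u" .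
    moreover have "(R ^^ j) w \<le> (R ^^ j) u"
      using automorphism_pow(2)[of j] wu by (simp add: riesz_automorphism_def)
    moreover have "riesz_disjoint (e - (R ^^ j) u) ((R ^^ j) u)"
      using component_disjoint[OF component_pow(2)[OF uC]] by (rule riesz_disjoint_sym)
    moreover have "0 \<le> w" "0 \<le> (R ^^ j) w"
      using wC component_pow(2)[OF wC] component_nonneg by blast+
    ultimately show "riesz_disjoint w ((R ^^ j) w)"
      using riesz_disjoint_mono2 by blast
  qed
  moreover have "w \<noteq> 0" using q by (simp only: w_def not_False_eq_True)
  moreover have "u \<le> c" using u by (simp add: riesz_components_def)
  ultimately show ?thesis using wC wu by (meson order_trans)
qed

lemma component_disjoint_partial_sup:
  assumes "\<And>i. f i \<in> \<C>" and w: "w \<in> \<C>" "w \<le> e - partial_sup f n" and i: "i < n"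
  shows "riesz_disjoint w (f i)"
proof (rule riesz_disjoint_mono2)
  show "riesz_disjoint (e - f i) (f i)"
    using component_disjoint[OF assms(1)] by (rule riesz_disjoint_sym)
  have "e - partial_sup f n \<le> e - f i"
    using partial_sup_upper[OF i, of f] by (rule diff_left_mono)
  then show "w \<le> e - f i" using w(2) by (rule order_trans[rotated])
qed (use assms component_nonneg in auto)

text \<open>The sequence lists the window \<open>S^(N-1) p, ..., p, ..., R^(N-1) p\<close> by a
  single index. A wandering \<open>w\<close> outside it keeps \<open>p + w\<close> wandering: the
  translates by \<open>R\<close> separate \<open>w\<close> from \<open>(R ^^ j) p\<close>, those by
  \<open>S\<close> separate \<open>p\<close> from \<open>(R ^^ j) w\<close>. Maximality then forces
  \<open>w = 0\<close>.\<close>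

lemma maximal_wandering_covers:
  assumes ap: "ceps_aperiodic e S e" and N: "1 \<le> N"
    and p: "p \<in> \<C>" "wandering N p" and max: "\<And>q. q \<in> \<C> \<Longrightarrow> wandering N q \<Longrightarrow> p \<le> q \<Longrightarrow> q = p"
  shows "partial_sup (\<lambda>i. (R ^^ i) ((S ^^ (N - 1)) p)) (2 * N - 1) = e"
proof (rule ccontr)
  define f where "f = (\<lambda>i. (R ^^ i) ((S ^^ (N - 1)) p))"
  assume "partial_sup (\<lambda>i. (R ^^ i) ((S ^^ (N - 1)) p)) (2 * N - 1) \<noteq> e"
  then have ne: "e - partial_sup f (2 * N - 1) \<noteq> 0" by (simp add: f_def)
  have fC: "f i \<in> \<C>" for i using p(1) by (simp add: f_def component_pow)
  obtain w where w: "w \<in> \<C>" "w \<le> e - partial_sup f (2 * N - 1)" "w \<noteq> 0" "wandering N w"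
    using ex_wandering_below[OF ap N component_compl[OF component_partial_sup[OF fC]] ne] by blast
  note dw = component_disjoint_partial_sup[OF fC w(1,2)]
  have wR: "riesz_disjoint w ((R ^^ j) p)" if "j < N" for j
    using dw[of "j + (N - 1)"] that by (simp add: f_def R_pow_S_pow_ge)
  have Rw: "riesz_disjoint p ((R ^^ j) w)" if "j < N" for j
  proof -
    \<comment> \<open>Disjointness of \<open>w\<close> from \<open>(S ^^ j) p\<close>, moved by
      \<open>R ^^ j\<close>, becomes disjointness of \<open>(R ^^ j) w\<close> from
      \<open>p\<close>.\<close>
    have "f (N - 1 - j) = (S ^^ j) p" using that by (simp add: f_def R_pow_S_pow_le)
    then have "riesz_disjoint w ((S ^^ j) p)" using dw[of "N - 1 - j"] that by simp
    then have "riesz_disjoint ((R ^^ j) w) ((R ^^ j) ((S ^^ j) p))"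
      unfolding riesz_automorphism_disjoint[OF automorphism_pow(2)] .
    then show ?thesis unfolding R_pow_S_pow by (rule riesz_disjoint_sym)
  qed
  have "p + w \<in> \<C>" using wR[of 0, THEN riesz_disjoint_sym] N by (intro add_component p(1) w(1)) simp
  moreover have "wandering N (p + w)"
    unfolding wandering_def
  proof
    fix j assume j: "j \<in> {1..<N}"
    have "riesz_disjoint (p + w) ((R ^^ j) p)"
      using j p(2) wR[of j] by (intro riesz_disjoint_add) (simp_all add: wandering_def)
    moreover have "riesz_disjoint (p + w) ((R ^^ j) w)"
      using j w(4) Rw[of j] by (intro riesz_disjoint_add) (simp_all add: wandering_def)
    ultimately have "riesz_disjoint ((R ^^ j) p + (R ^^ j) w) (p + w)"
      by (intro riesz_disjoint_add) (auto intro: riesz_disjoint_sym)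
    then show "riesz_disjoint (p + w) ((R ^^ j) (p + w))"
      unfolding linear_add[OF linear_pow(2)] by (rule riesz_disjoint_sym)
  qed
  ultimately have "p + w = p" by (rule max) (use component_nonneg[OF w(1)] in simp)
  then show False using w(3) by simp
qed

text \<open>Both covers are shifts of the two-sided one and \<open>e\<close> is invariant. Applying
  \<open>R ^^ N\<close> makes the exponents of \<open>R\<close> start at 1, as a return must be
  strictly later; applying \<open>S ^^ (N - 1)\<close> makes those of \<open>S\<close> start at
  0.\<close>

lemma ex_sweeping_wandering:
  assumes ap: "ceps_aperiodic e S e" and N: "1 \<le> N"
  shows "\<exists>p\<in>\<C>. wandering N p \<and> partial_sup (\<lambda>i. (S ^^ i) p) (2 * N - 1) = e \<and>
    partial_sup (\<lambda>i. (R ^^ Suc i) p) (2 * N - 1) = e"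
proof -
  obtain p where p: "p \<in> \<C>" "wandering N p"
    and max: "\<And>q. q \<in> \<C> \<Longrightarrow> wandering N q \<Longrightarrow> p \<le> q \<Longrightarrow> q = p"
    using ex_maximal_wandering by blast
  have cover: "partial_sup (\<lambda>i. (R ^^ i) ((S ^^ (N - 1)) p)) (2 * N - 1) = e"
    using ap N p max by (rule maximal_wandering_covers)
  have "(R ^^ N) ((R ^^ i) ((S ^^ (N - 1)) p)) = (R ^^ Suc i) p" for i
  proof -
    have "(R ^^ N) ((R ^^ i) ((S ^^ (N - 1)) p)) = (R ^^ (N + i)) ((S ^^ (N - 1)) p)"
      by (simp add: funpow_add)
    also have "\<dots> = (R ^^ (N + i - (N - 1))) p" by (rule R_pow_S_pow_ge) simp
    also have "N + i - (N - 1) = Suc i" using N by simp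
    finally show ?thesis .
  qed
  then have 1: "partial_sup (\<lambda>i. (R ^^ Suc i) p) (2 * N - 1) = e"
    using arg_cong[OF cover, of "R ^^ N"]
    by (simp only: partial_sup_automorphism[OF automorphism_pow(2)] funpow_unit)
  have "e = partial_sup (\<lambda>i. (S ^^ (N - 1)) ((R ^^ i) ((S ^^ (N - 1)) p))) (2 * N - 1)"
    using arg_cong[OF cover, of "S ^^ (N - 1)"]
    by (simp only: partial_sup_automorphism[OF automorphism_pow(1)] funpow_unit)
  \<comment> \<open>The shifted family is enumerated in reverse, with exponents 2N - 2 - i, so the
    suprema are compared termwise; equality follows because nothing exceeds
    \<open>e\<close>.\<close>
  also have "\<dots> \<le> partial_sup (\<lambda>i. (S ^^ i) p) (2 * N - 1)"
  proof (rule partial_sup_least)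
    show "0 \<le> partial_sup (\<lambda>i. (S ^^ i) p) (2 * N - 1)"
      using component_partial_sup[OF component_pow(1)[OF p(1)]] by (rule component_nonneg)
    fix i assume i: "i < 2 * N - 1"
    have "(S ^^ (N - 1)) ((R ^^ i) ((S ^^ (N - 1)) p)) = (S ^^ (2 * N - 2 - i)) p"
    proof (cases "i \<le> N - 1")
      case True
      then have "(S ^^ (N - 1)) ((R ^^ i) ((S ^^ (N - 1)) p)) = (S ^^ (N - 1)) ((S ^^ (N - 1 - i)) p)"
        by (simp add: R_pow_S_pow_le)
      also have "\<dots> = (S ^^ (N - 1 + (N - 1 - i))) p" by (simp add: funpow_add)
      also have "N - 1 + (N - 1 - i) = 2 * N - 2 - i" using True by simp
      finally show ?thesis .
    next
      case False
      then show ?thesis using i by (simp add: R_pow_S_pow_ge S_pow_R_pow_ge mult_2)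
    qed
    also have "\<dots> \<le> partial_sup (\<lambda>i. (S ^^ i) p) (2 * N - 1)"
      by (rule partial_sup_upper[of _ _ "\<lambda>i. (S ^^ i) p"]) (use N in simp)
    finally show "(S ^^ (N - 1)) ((R ^^ i) ((S ^^ (N - 1)) p)) \<le> partial_sup (\<lambda>i. (S ^^ i) p) (2 * N - 1)" .
  qed
  finally have "partial_sup (\<lambda>i. (S ^^ i) p) (2 * N - 1) = e"
    using component_le[OF component_partial_sup[OF component_pow(1)[OF p(1)]]] by (rule antisym[rotated])
  then have 2: "partial_sup (\<lambda>i. (S ^^ i) p) (2 * N - 1) = e" .
  show ?thesis
    using p 1 2 by (intro bexI[of _ p] conjI)
qed

text \<open>The N translates \<open>p, R p, ..., R^(N-1) p\<close> are pairwise disjoint, so their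
  sum stays below \<open>e\<close>, and all have the expectation \<open>T p\<close>.\<close>

lemma wandering_expectation_le:
  assumes p: "p \<in> \<C>" "wandering N p"
  shows "real N *\<^sub>R T p \<le> e"
proof -
  have dis: "riesz_disjoint ((R ^^ i) p) ((R ^^ j) p)" if "i < j" "j < N" for i j
  proof -
    have "riesz_disjoint p ((R ^^ (j - i)) p)"
    proof -
      have "j - i \<in> {1..<N}" using that by auto
      with p(2) show ?thesis unfolding wandering_def by (rule bspec)
    qed
    then have "riesz_disjoint ((R ^^ i) p) ((R ^^ i) ((R ^^ (j - i)) p))"
      unfolding riesz_automorphism_disjoint[OF automorphism_pow(2)] .
    then show ?thesis using that funpow_add[of i "j - i" R] by simp
  qed
  have "n \<le> N \<Longrightarrow> (\<Sum>i<n. (R ^^ i) p) \<in> \<C>" for n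
  proof (induction n)
    case (Suc n)
    have "riesz_disjoint (\<Sum>i<n. (R ^^ i) p) ((R ^^ n) p)"
      using Suc.prems by (intro riesz_disjoint_sum dis) auto
    then show ?case using Suc component_pow(2)[OF p(1)] by (simp add: add_component)
  qed (simp add: component_0)
  then have "(\<Sum>i<N. (R ^^ i) p) \<le> e" by (simp add: component_le)
  then have "T (\<Sum>i<N. (R ^^ i) p) \<le> e" using T_mono T_unit by fastforce
  then show ?thesis by (simp add: linear_sum[OF linear_T] T_R_pow sum_constant_scaleR)
qed

end


section \<open>Cyclic towers\<close>

text \<open>Read pointwise: every point was in \<open>p\<close> at most M - 1 steps ago, the present
  included, and will be in \<open>p\<close> again after between 1 and M steps.\<close>

locale sweeping_component = preserved_expectation +
  fixes p :: 'a and M :: nat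
  assumes component_p: "p \<in> riesz_components e"
    and sweep_forward: "partial_sup (\<lambda>i. (S ^^ i) p) M = e"
    and sweep_backward: "partial_sup (\<lambda>i. (inv S ^^ Suc i) p) M = e"
begin

abbreviation forward :: "nat \<Rightarrow> 'a" where "forward \<equiv> \<lambda>i. (S ^^ i) p"
abbreviation backward :: "nat \<Rightarrow> 'a" where "backward \<equiv> \<lambda>i. (R ^^ Suc i) p"

lemma component_forward: "forward i \<in> \<C>" and component_backward: "backward i \<in> \<C>"
  using component_pow(1)[OF component_p, of i] component_pow(2)[OF component_p, of "Suc i"] by simp_all

text \<open>This is \<open>first_return e S p (Suc n)\<close>: the part of \<open>p\<close> whose
  first return takes exactly n + 1 steps. The form through \<open>fresh_part\<close> makes the
  disjointification lemmas available.\<close>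

definition tower_base :: "nat \<Rightarrow> 'a" where
  "tower_base n = inf p (fresh_part backward n)"

lemma component_tower_base: "tower_base n \<in> \<C>"
  unfolding tower_base_def by (intro component_inf component_p component_fresh_part component_backward)

lemma S_pow_backward: "(S ^^ a) (backward (a + l)) = backward l"
proof -
  have "(S ^^ a) (backward (a + l)) = (R ^^ (Suc (a + l) - a)) p" by (rule S_pow_R_pow_le) simp
  also have "Suc (a + l) - a = Suc l" by simp
  finally show ?thesis .
qed

text \<open>The exponents 1, ..., a + l of \<open>R\<close> shift to 1 - a, ..., l. Those from 1 - a
  to 0 form the forward family below \<open>a\<close>, those from 1 to l the backward family below
  \<open>l\<close>.\<close>

lemma S_pow_partial_sup_backward:
  "(S ^^ a) (partial_sup backward (a + l)) = sup (partial_sup forward a) (partial_sup backward l)"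
proof (induction a)
  case 0
  show ?case using component_nonneg[OF component_partial_sup[OF component_backward]]
    by (simp add: sup_absorb2)
next
  case (Suc a)
  have step: "S (partial_sup backward (Suc m)) = sup (partial_sup backward m) p" for m
  proof (induction m)
    case 0
    then show ?case using component_nonneg[OF component_p] linear_0[OF riesz_automorphism_linear[OF automorphism]]
      by (simp add: riesz_automorphism_sup[OF automorphism])
  next
    case (Suc m)
    have "S (partial_sup backward (Suc (Suc m))) = sup (sup (partial_sup backward m) p) (backward m)"
      using Suc by (simp add: riesz_automorphism_sup[OF automorphism])
    also have "\<dots> = sup (partial_sup backward (Suc m)) p" by (simp add: ac_simps)
    finally show ?case .
  qed
  have "(S ^^ Suc a) (partial_sup backward (Suc a + l)) = (S ^^ a) (S (partial_sup backward (Suc (a + l))))"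
    by (simp add: funpow_swap1)
  also have "\<dots> = sup ((S ^^ a) (partial_sup backward (a + l))) ((S ^^ a) p)"
    unfolding step by (rule riesz_automorphism_sup[OF automorphism_pow(1)])
  also have "\<dots> = sup (partial_sup forward (Suc a)) (partial_sup backward l)"
    unfolding Suc by (simp add: ac_simps)
  finally show ?case .
qed

text \<open>Level \<open>a\<close> of the tower over \<open>tower_base (a + l)\<close> consists of
  what last visited \<open>p\<close> exactly \<open>a\<close> steps ago and will next visit it in
  \<open>l + 1\<close> steps. Disjointness and exhaustion of the levels thereby reduce to those of
  the two families of fresh parts.\<close>

lemma S_pow_tower_base:
  "(S ^^ a) (tower_base (a + l)) = inf (fresh_part forward a) (fresh_part backward l)"
proof -
  note G = automorphism_pow(1)[of a]
  have "(S ^^ a) (tower_base (a + l)) =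
      inf ((S ^^ a) p) (inf (backward l) (e - sup (partial_sup forward a) (partial_sup backward l)))"
    unfolding tower_base_def fresh_part_def riesz_automorphism_inf[OF G]
      linear_diff[OF linear_pow(1)] S_pow_backward S_pow_partial_sup_backward funpow_unit ..
  then show ?thesis unfolding compl_sup fresh_part_def by (simp only: inf_aci)
qed

lemma tower_base_eq_0:
  assumes "M \<le> n"
  shows "tower_base n = 0"
proof -
  have "e \<le> partial_sup backward n"
    using partial_sup_mono[OF assms, of backward] by (simp only: sweep_backward)
  then have "tower_base n \<le> 0"
    unfolding tower_base_def fresh_part_def by (intro le_infI2) simp
  then show ?thesis using component_nonneg[OF component_tower_base] by (rule antisym)
qed

text \<open>Below \<open>e\<close>, \<open>inf c\<close> is the band projection onto
  \<open>c\<close>, which is linear; so it may be interchanged with the sum.\<close>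

lemma sum_inf_fresh_part_backward:
  assumes "c \<in> \<C>"
  shows "(\<Sum>l<M. inf c (fresh_part backward l)) = c"
proof -
  have C: "fresh_part backward l \<in> \<C>" for l by (rule component_fresh_part[OF component_backward])
  have "(\<Sum>l<M. inf c (fresh_part backward l)) = (\<Sum>l<M. band_proj c (fresh_part backward l))"
    using C by (intro sum.cong) (simp_all add: band_proj_le_unit[OF assms] component_iff)
  also have "\<dots> = band_proj c (\<Sum>l<M. fresh_part backward l)"
    by (rule linear_sum[OF linear_band_proj[OF assms], symmetric])
  also have "(\<Sum>l<M. fresh_part backward l) = e"
    using sum_fresh_part[of backward M, OF component_backward] by (simp only: sweep_backward)
  also have "band_proj c e = c"
    using band_proj_le_unit[OF assms unit_nonneg] component_le[OF assms] by (simp add: inf_absorb1)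
  finally show ?thesis .
qed

lemma sum_tower_base: "(\<Sum>n<M. tower_base n) = p"
  unfolding tower_base_def by (rule sum_inf_fresh_part_backward[OF component_p])

text \<open>Index \<open>(n, a)\<close> stands for level \<open>a\<close> of the tower of height \<open>n + 1\<close>.\<close>

definition levels :: "(nat \<times> nat) set" where
  "levels = (SIGMA n:{..<M}. {..n})"

lemma finite_levels: "finite levels"
  by (simp add: levels_def)

definition level :: "nat \<times> nat \<Rightarrow> 'a" where
  "level = (\<lambda>(n, a). (S ^^ a) (tower_base n))"

lemma component_level: "level i \<in> \<C>"
  by (cases i) (simp add: level_def component_pow component_tower_base)

lemma level_eq: "a \<le> n \<Longrightarrow> level (n, a) = inf (fresh_part forward a) (fresh_part backward (n - a))"
  using S_pow_tower_base[of a "n - a"] by (simp add: level_def)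

text \<open>Distinct indices (n, a) differ in \<open>a\<close> or in \<open>n - a\<close>, and then
  the forward or the backward fresh parts are disjoint.\<close>

lemma level_disjoint:
  assumes "i \<in> levels" "j \<in> levels" "i \<noteq> j"
  shows "riesz_disjoint (level i) (level j)"
proof -
  obtain n a m b where ij: "i = (n, a)" "j = (m, b)" "a \<le> n" "b \<le> m"
    using assms by (auto simp: levels_def)
  let ?F = "fresh_part forward" and ?B = "fresh_part backward"
  have eq: "level i = inf (?F a) (?B (n - a))" "level j = inf (?F b) (?B (m - b))"
    using ij by (simp_all add: level_eq)
  have nn: "0 \<le> level i" "0 \<le> level j" using component_level component_nonneg by auto
  show ?thesis
  proof (cases "a = b")
    case False
    have "riesz_disjoint (?F a) (?F b)" using component_forward False by (rule fresh_part_disjoint)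
    then show ?thesis by (rule riesz_disjoint_mono2) (use nn in \<open>auto simp: eq\<close>)
  next
    case True
    then have "n - a \<noteq> m - b" using ij assms(3) by auto
    with component_backward have "riesz_disjoint (?B (n - a)) (?B (m - b))" by (rule fresh_part_disjoint)
    then show ?thesis by (rule riesz_disjoint_mono2) (use nn in \<open>auto simp: eq\<close>)
  qed
qed

lemma sum_levels: "(\<Sum>i\<in>levels. f i) = (\<Sum>n<M. \<Sum>a\<le>n. f (n, a))"
  unfolding levels_def by (subst sum.Sigma) (auto intro!: sum.cong)

lemma sum_level: "(\<Sum>i\<in>levels. level i) = e"
proof -
  let ?F = "fresh_part forward" and ?B = "fresh_part backward"
  have "(\<Sum>i\<in>levels. level i) = (\<Sum>n<M. \<Sum>a\<le>n. inf (?F a) (?B (n - a)))"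
    unfolding sum_levels by (intro sum.cong refl) (simp add: level_eq)
  also have "\<dots> = (\<Sum>(a, l)\<in>{(a, l). a + l < M}. inf (?F a) (?B l))"
    by (rule sum.triangle_reindex[symmetric])
  \<comment> \<open>The triangle is filled up to a square, where the double sum factors into a
    forward and a backward sum; the added terms would be levels of towers with empty base.\<close>
  also have "\<dots> = (\<Sum>(a, l)\<in>{..<M} \<times> {..<M}. inf (?F a) (?B l))"
  proof (rule sum.mono_neutral_left)
    have "inf (?F a) (?B l) = 0" if "M \<le> a + l" for a l
      unfolding S_pow_tower_base[symmetric] tower_base_eq_0[OF that] by (rule linear_0[OF linear_pow(1)])
    then show "\<forall>i\<in>{..<M} \<times> {..<M} - {(a, l). a + l < M}. (case i of (a, l) \<Rightarrow> inf (?F a) (?B l)) = 0"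
      by (simp add: case_prod_unfold not_less)
  qed auto
  also have "\<dots> = (\<Sum>a<M. \<Sum>l<M. inf (?F a) (?B l))" by (rule sum.cartesian_product[symmetric])
  also have "\<dots> = (\<Sum>a<M. ?F a)"
    by (simp only: sum_inf_fresh_part_backward component_fresh_part component_forward)
  also have "\<dots> = e" using sum_fresh_part[of forward M, OF component_forward] by (simp only: sweep_forward)
  finally show ?thesis .
qed

section \<open>The cyclic permutation of the levels\<close>

text \<open>The piece of \<open>f\<close> on level (n, a), brought down to the base of its tower. In
  these coordinates a change of level is only a change of the exponent of \<open>S\<close>.\<close>

definition base_part :: "nat \<times> nat \<Rightarrow> 'a \<Rightarrow> 'a" where
  "base_part = (\<lambda>(n, a) f. band_proj (tower_base n) ((R ^^ a) f))"

text \<open>The exponent is a + 1 below the top and 0 at \<open>a = n\<close>, so the map acts as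
  \<open>S\<close> on lower levels and as \<open>R ^^ n\<close> on the top level.\<close>

definition cyclic :: "'a \<Rightarrow> 'a" where
  "cyclic f = (\<Sum>(n, a)\<in>levels. (S ^^ (Suc a mod Suc n)) (base_part (n, a) f))"

lemma linear_base_part: "linear (base_part i)"
  using linear_compose[OF linear_pow(2) linear_band_proj[OF component_tower_base]]
  by (cases i) (simp add: base_part_def o_def)

lemma base_part_bounds:
  assumes "0 \<le> f" "f \<le> e"
  shows "0 \<le> base_part (n, a) f" "base_part (n, a) f \<le> tower_base n"
proof -
  have nn: "0 \<le> (R ^^ a) f" using assms by (simp add: riesz_automorphism_nonneg[OF automorphism_pow(2)])
  have "(R ^^ a) f \<le> (R ^^ a) e"
    using assms(2) automorphism_pow(2)[of a] by (simp add: riesz_automorphism_def)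
  then have "base_part (n, a) f = inf (tower_base n) ((R ^^ a) f)"
    using nn by (simp add: base_part_def band_proj_le_unit component_tower_base funpow_unit)
  then show "0 \<le> base_part (n, a) f" "base_part (n, a) f \<le> tower_base n"
    using nn component_nonneg[OF component_tower_base] by simp_all
qed

lemma linear_cyclic: "linear cyclic"
proof -
  have "linear (\<lambda>f. (S ^^ k) (base_part i f))" for k i
    using linear_compose[OF linear_base_part linear_pow(1)] by (simp add: o_def)
  then show ?thesis unfolding cyclic_def case_prod_unfold by (intro linear_compose_sum) blast
qed

lemma cyclic_nonneg:
  assumes "0 \<le> f"
  shows "0 \<le> cyclic f"
  using assms unfolding cyclic_def base_part_def
  by (auto intro!: sum_nonneg band_proj_bounds component_tower_base
      simp: riesz_automorphism_nonneg[OF automorphism_pow(1)] riesz_automorphism_nonneg[OF automorphism_pow(2)])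

lemma S_pow_base_part: "(S ^^ a) (base_part (n, a) f) = band_proj (level (n, a)) f"
  using band_proj_automorphism[OF automorphism_pow(1)[of a] funpow_unit(1) component_tower_base]
  by (simp add: base_part_def level_def)

lemma decomposition: "(\<Sum>(n, a)\<in>levels. (S ^^ a) (base_part (n, a) f)) = f"
proof -
  have "(\<Sum>i\<in>levels. band_proj (level i) f) = f"
    using finite_levels component_level level_disjoint sum_level by (rule sum_band_proj)
  then show ?thesis by (simp add: S_pow_base_part case_prod_unfold)
qed

text \<open>Each summand differs from the corresponding one of \<open>decomposition\<close> only by
  a power of \<open>S\<close>, which \<open>T\<close> does not see.\<close>

lemma T_cyclic: "T (cyclic f) = T f"
proof -
  have "T (cyclic f) = T (\<Sum>(n, a)\<in>levels. (S ^^ a) (base_part (n, a) f))"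
    by (simp add: cyclic_def case_prod_unfold linear_sum[OF linear_T] T_S_pow)
  then show ?thesis by (simp only: decomposition)
qed

lemma sum_shift_mod: "(\<Sum>a\<le>n. g (Suc a mod Suc n)) = (\<Sum>a\<le>n. g a)"
  for g :: "nat \<Rightarrow> 'b::comm_monoid_add"
proof -
  have "(\<Sum>a\<le>n. g (Suc a mod Suc n)) = (\<Sum>a<n. g (Suc a mod Suc n)) + g 0"
    by (simp flip: lessThan_Suc_atMost)
  also have "(\<Sum>a<n. g (Suc a mod Suc n)) = (\<Sum>a<n. g (Suc a))" by (intro sum.cong) auto
  finally show ?thesis by (simp add: sum.atMost_shift add.commute)
qed

lemma cyclic_unit: "cyclic e = e"
proof -
  have "base_part (n, a) e = tower_base n" for n a
    using band_proj_le_unit[OF component_tower_base unit_nonneg order_refl]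
      component_le[OF component_tower_base]
    by (simp add: base_part_def funpow_unit inf_absorb1)
  then have "cyclic e = (\<Sum>n<M. \<Sum>a\<le>n. (S ^^ (Suc a mod Suc n)) (tower_base n))"
    by (simp add: cyclic_def sum_levels)
  also have "\<dots> = (\<Sum>n<M. \<Sum>a\<le>n. (S ^^ a) (tower_base n))"
    by (intro sum.cong refl sum_shift_mod)
  also have "\<dots> = (\<Sum>i\<in>levels. level i)" by (simp add: sum_levels level_def)
  finally show ?thesis by (simp only: sum_level)
qed

text \<open>The argument lies in the band of level (n, a), which is disjoint from all other levels,
  so a single summand of \<open>cyclic\<close> survives.\<close>

lemma cyclic_level:
  assumes "(n, a) \<in> levels"
  shows "cyclic ((S ^^ a) (band_proj (tower_base n) f)) =
    (S ^^ (Suc a mod Suc n)) (band_proj (tower_base n) f)"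
proof -
  let ?x = "band_proj (tower_base n) f" and ?y = "(S ^^ a) (band_proj (tower_base n) f)"
  have y: "?y = band_proj (level (n, a)) ((S ^^ a) f)"
    using band_proj_automorphism[OF automorphism_pow(1)[of a] funpow_unit(1) component_tower_base]
    by (simp add: level_def)
  have off: "base_part (m, b) ?y = 0" if "(m, b) \<in> levels - {(n, a)}" for m b
  proof -
    have "riesz_disjoint (level (m, b)) (level (n, a))" using that assms by (intro level_disjoint) auto
    then have "(S ^^ b) (base_part (m, b) ?y) = 0"
      unfolding S_pow_base_part y by (intro band_proj_band_proj_disjoint component_level)
    then show ?thesis
      using R_pow_S_pow[of b "base_part (m, b) ?y"] linear_0[OF linear_pow(2)] by simp
  qed
  have "cyclic ?y = (\<Sum>(m, b)\<in>{(n, a)}. (S ^^ (Suc b mod Suc m)) (base_part (m, b) ?y))"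
    unfolding cyclic_def
  proof (rule sum.mono_neutral_right)
    show "\<forall>i\<in>levels - {(n, a)}. (case i of (m, b) \<Rightarrow> (S ^^ (Suc b mod Suc m)) (base_part (m, b) ?y)) = 0"
    proof
      fix i assume i: "i \<in> levels - {(n, a)}"
      obtain m b where mb: "i = (m, b)" by (cases i)
      show "(case i of (m, b) \<Rightarrow> (S ^^ (Suc b mod Suc m)) (base_part (m, b) ?y)) = 0"
        using off[OF i[unfolded mb]] by (simp only: mb case_prod_conv linear_0[OF linear_pow(1)])
    qed
  qed (use assms finite_levels in auto)
  also have "base_part (n, a) ?y = ?x"
    by (simp add: base_part_def band_proj_idem component_tower_base)
  then have "(\<Sum>(m, b)\<in>{(n, a)}. (S ^^ (Suc b mod Suc m)) (base_part (m, b) ?y)) =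
      (S ^^ (Suc a mod Suc n)) ?x" by simp
  finally show ?thesis .
qed

lemma cyclic_funpow_level:
  assumes "n < M"
  shows "a \<le> n \<Longrightarrow> (cyclic ^^ m) ((S ^^ a) (band_proj (tower_base n) f)) =
    (S ^^ ((a + m) mod Suc n)) (band_proj (tower_base n) f)"
proof (induction m)
  case (Suc m)
  have "(n, (a + m) mod Suc n) \<in> levels"
    using assms by (auto simp: levels_def less_Suc_eq_le[symmetric])
  from cyclic_level[OF this] show ?case using Suc by (simp add: mod_Suc_eq)
qed simp

text \<open>The heights n + 1 are at most M, so \<open>fact M\<close> is a common multiple of all
  cycle lengths.\<close>

lemma cyclic_funpow_fact: "(cyclic ^^ fact M) f = f"
proof -
  have "(cyclic ^^ fact M) f = (cyclic ^^ fact M) (\<Sum>(n, a)\<in>levels. (S ^^ a) (base_part (n, a) f))"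
    by (simp only: decomposition)
  also have "\<dots> = (\<Sum>(n, a)\<in>levels. (cyclic ^^ fact M) ((S ^^ a) (base_part (n, a) f)))"
    by (simp add: linear_sum[OF linear_funpow[OF linear_cyclic]] case_prod_unfold)
  also have "\<dots> = (\<Sum>(n, a)\<in>levels. (S ^^ a) (base_part (n, a) f))"
  proof (intro sum.cong refl, clarify)
    fix n a assume "(n, a) \<in> levels"
    then have na: "n < M" "a \<le> n" by (auto simp: levels_def)
    have "Suc n dvd fact M" using na by (intro dvd_fact) auto
    then obtain q where "fact M = Suc n * q" by (rule dvdE)
    then have "(a + fact M) mod Suc n = a" using na by (simp only: mod_mult_self2) simp
    then show "(cyclic ^^ fact M) ((S ^^ a) (base_part (n, a) f)) = (S ^^ a) (base_part (n, a) f)"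
      using cyclic_funpow_level[OF na] by (simp add: base_part_def)
  qed
  finally show ?thesis by (simp only: decomposition)
qed

lemma cyclic_mono: "f \<le> g \<Longrightarrow> cyclic f \<le> cyclic g"
  using cyclic_nonneg[of "g - f"] by (simp add: linear_diff[OF linear_cyclic])

text \<open>Finite order supplies the inverse as a power of \<open>cyclic\<close>; being positive as
  well, it shows that the order is reflected.\<close>

lemma automorphism_cyclic: "riesz_automorphism cyclic"
proof -
  obtain k where k: "fact M = Suc k" using fact_gt_zero[of M, where 'a = nat] gr0_implies_Suc by blast
  have 1: "(cyclic ^^ k) (cyclic f) = f" for f
    using cyclic_funpow_fact[of f] unfolding k by (simp add: funpow_swap1)
  have 2: "cyclic ((cyclic ^^ k) f) = f" for f
    using cyclic_funpow_fact[of f] unfolding k by simp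
  have "bij cyclic" using 1 2 by (intro o_bij[of "cyclic ^^ k"]) (auto simp: fun_eq_iff)
  moreover have "f \<le> g" if "cyclic f \<le> cyclic g" for f g
  proof -
    have "(cyclic ^^ k) (cyclic f) \<le> (cyclic ^^ k) (cyclic g)"
      using that by (induction k) (simp_all add: cyclic_mono)
    then show ?thesis by (simp only: 1)
  qed
  ultimately show ?thesis using linear_cyclic cyclic_mono unfolding riesz_automorphism_def by blast
qed

text \<open>Off the top levels \<open>cyclic\<close> agrees with \<open>S\<close>, and the top levels together have the same
  expectation as \<open>p\<close>.\<close>

lemma T_abs_diff_le:
  assumes u: "u \<in> \<C>"
  shows "T \<bar>S u - cyclic u\<bar> \<le> 2 *\<^sub>R T p"
proof -
  define x where "x = (\<lambda>n. base_part (n, n) u)"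
  \<comment> \<open>On the tower with index n, \<open>S\<close> sends the top piece to
    \<open>(S ^^ Suc n) (x n)\<close> and \<open>cyclic\<close> sends it to \<open>x n\<close>. Both
    images are bounded by translates of \<open>tower_base n\<close>, which gives the factor
    2.\<close>
  define z where "z = (\<Sum>n<M. (S ^^ Suc n) (tower_base n) + tower_base n)"
  have x: "0 \<le> x n" "x n \<le> tower_base n" for n
    using base_part_bounds[of u] component_nonneg[OF u] component_le[OF u] by (simp_all add: x_def)
  have "S u = S (\<Sum>(n, a)\<in>levels. (S ^^ a) (base_part (n, a) u))" by (simp only: decomposition)
  also have "\<dots> = (\<Sum>(n, a)\<in>levels. (S ^^ Suc a) (base_part (n, a) u))"
    by (simp add: linear_sum[OF riesz_automorphism_linear[OF automorphism]] case_prod_unfold)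
  finally have "S u - cyclic u = (\<Sum>n<M. \<Sum>a\<le>n.
      (S ^^ Suc a) (base_part (n, a) u) - (S ^^ (Suc a mod Suc n)) (base_part (n, a) u))"
    by (simp add: cyclic_def sum_levels sum_subtractf)
  \<comment> \<open>For a < n the two exponents coincide and the terms cancel; at a = n the
    remainder is 0.\<close>
  also have "\<dots> = (\<Sum>n<M. (S ^^ Suc n) (x n) - x n)"
    by (intro sum.cong refl) (simp add: x_def flip: lessThan_Suc_atMost)
  finally have "\<bar>S u - cyclic u\<bar> \<le> (\<Sum>n<M. \<bar>(S ^^ Suc n) (x n) - x n\<bar>)"
    by (simp only: sum_abs)
  also have "\<dots> \<le> z"
    unfolding z_def
  proof (rule sum_mono)
    fix n
    have le: "(S ^^ Suc n) (x n) \<le> (S ^^ Suc n) (tower_base n)"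
      using x(2)[of n] automorphism_pow(1)[of "Suc n"] unfolding riesz_automorphism_def by blast
    have "0 \<le> (S ^^ Suc n) (x n)"
      using x(1)[of n] by (simp only: riesz_automorphism_nonneg[OF automorphism_pow(1)])
    then have "\<bar>(S ^^ Suc n) (x n) - x n\<bar> \<le> (S ^^ Suc n) (x n) + x n"
      using abs_triangle_ineq4[of "(S ^^ Suc n) (x n)" "x n"] x(1)[of n] by (simp only: abs_of_nonneg)
    also have "\<dots> \<le> (S ^^ Suc n) (tower_base n) + tower_base n" using le x(2) by (rule add_mono)
    finally show "\<bar>(S ^^ Suc n) (x n) - x n\<bar> \<le> (S ^^ Suc n) (tower_base n) + tower_base n" .
  qed
  finally have "T \<bar>S u - cyclic u\<bar> \<le> T z" by (rule T_mono)
  also have "T z = (\<Sum>n<M. T (tower_base n)) + (\<Sum>n<M. T (tower_base n))"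
    unfolding z_def linear_sum[OF linear_T] linear_add[OF linear_T] T_S_pow sum.distrib ..
  also have "\<dots> = 2 *\<^sub>R T p"
    unfolding linear_sum[OF linear_T, symmetric] sum_tower_base by (simp add: scaleR_2)
  finally show ?thesis .
qed

end


section \<open>Periodicity and the final assembly\<close>

text \<open>Once \<open>k\<close> exceeds the period K, the translate
  \<open>(inv G ^^ K) c = c\<close> occurs in the supremum subtracted in
  \<open>first_return\<close>, which leaves at most \<open>inf c (e - c) = 0\<close>. The bound is
  \<open>Suc K\<close> so that K lies in \<open>{1..<k}\<close>.\<close>

lemma (in weak_unit) finite_order_periodic:
  assumes G: "riesz_automorphism G" "G e = e" and K: "1 \<le> K" "\<And>f. (G ^^ K) f = f"
  shows "ceps_periodic e G e"
  unfolding ceps_periodic_def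
proof (intro conjI exI[of _ "Suc K"] ballI impI allI)
  fix c k assume c: "c \<in> \<C>" and k: "Suc K \<le> k"
  have b: "bij G" using G(1) by (simp add: riesz_automorphism_def)
  have inv_e: "inv G e = e" using G(2) b by (metis bij_is_inj inv_f_f)
  have C: "(inv G ^^ j) c \<in> \<C>" for j
    using c by (induction j) (simp_all add: component_automorphism riesz_automorphism_inv G(1) inv_e)
  have fix_c: "(inv G ^^ K) c = c"
    using inv_fn_o_fn_is_id[OF b, of K] K(2)[of c] by (metis comp_apply)
  define A where "A = insert 0 ((\<lambda>j. (inv G ^^ j) c) ` {1..<k})"
  have A: "A \<noteq> {}" "A \<subseteq> \<C>" using C component_0 by (auto simp: A_def)
  have bdd: "bdd_above A" using A(2) component_le by (meson bdd_aboveI subsetD)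
  have "c \<in> A" unfolding A_def using K(1) k fix_c by (intro insertI2 image_eqI[of _ _ K]) simp_all
  then have "e - Sup A \<le> e - c" using bdd by (intro diff_left_mono cSup_upper)
  then have "first_return e G c k \<le> inf c (e - c)"
    unfolding first_return_def A_def[symmetric] by (intro inf_mono) simp_all
  also have "\<dots> = 0"
    using component_disjoint[OF c] component_nonneg[OF c] component_le[OF c]
    by (simp add: riesz_disjoint_nonneg)
  finally have "first_return e G c k \<le> 0" .
  moreover have "first_return e G c k \<in> \<C>"
    unfolding first_return_def A_def[symmetric]
    by (intro component_inf component_compl component_Sup A C c)
  ultimately show "first_return e G c k = 0" using component_nonneg by (intro antisym)
qed (simp_all add: component_unit)

text \<open>Injectivity comes from strict positivity: if \<open>S f = 0\<close>, then \<open>T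
  \<bar>f\<bar> = T (S \<bar>f\<bar>) = T \<bar>S f\<bar> = 0\<close>.\<close>

lemma ceps_automorphism:
  assumes "ceps T S e" "strictly_positive T" "surj S"
  shows "riesz_automorphism S"
proof (rule riesz_homomorphism_bij_automorphism)
  show h: "riesz_homomorphism S" using assms(1) by (simp add: ceps_def)
  then have lin: "linear S" by (simp add: riesz_homomorphism_def)
  have "f = 0" if "S f = 0" for f
  proof -
    have "S \<bar>f\<bar> = \<bar>S f\<bar>"
      using h linear_neg[OF lin] by (simp add: riesz_homomorphism_def abs_lattice)
    then have "T (S \<bar>f\<bar>) = T 0" by (simp add: that)
    moreover have "T (S \<bar>f\<bar>) = T \<bar>f\<bar>" "T 0 = 0"
      using assms(1) by (simp_all add: ceps_def conditional_expectation_def linear_0)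
    ultimately have "\<bar>f\<bar> = 0" using assms(2) unfolding strictly_positive_def by (metis abs_ge_zero)
    then show ?thesis by simp
  qed
  then have "inj S" by (simp add: linear_injective_0[OF lin])
  then show "bij S" using assms(3) by (simp add: bij_def)
qed

theorem theorem5p1:
  fixes T S :: "'a::dedekind_complete_riesz_space \<Rightarrow> 'a"
    and e :: 'a
    and J :: "'a \<Rightarrow> 'u::dedekind_complete_riesz_space"
    and \<epsilon> :: real
  assumes "ceps T S e"
    and "conditionally_ergodic T S"
    and "strictly_positive T"
    and "universal_completion J"
    and "T_universally_complete J T"
    and "surj S"
    and "ceps_aperiodic e S e"
    and "0 < \<epsilon>" and "\<epsilon> < 1"
  shows "\<exists>S'. riesz_homomorphism S' \<and> surj S' \<and> ceps T S' e \<and> ceps_periodic e S' e \<and>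
    (SUP u\<in>riesz_components e. T \<bar>S u - S' u\<bar>) \<le> \<epsilon> *\<^sub>R e"
proof -
  have T: "weak_order_unit e" "conditional_expectation T" "T e = e"
    using assms(1) by (simp_all add: ceps_def)
  interpret preserved_expectation e T S
    by (intro preserved_expectation.intro weak_unit.intro preserved_expectation_axioms.intro)
      (use assms(1) ceps_automorphism[OF assms(1,3,6)] in
        \<open>auto simp: ceps_def conditional_expectation_def\<close>)
  \<comment> \<open>Chosen so that the error 2 \<open>T p\<close> is at most \<epsilon> N
    \<open>T p\<close>, which the wandering bound places below \<epsilon> \<open>e\<close>.\<close>
  obtain N :: nat where N: "2 / \<epsilon> \<le> real N" using real_arch_simple by blast
  have "0 < 2 / \<epsilon>" using assms(8) by simp
  then have N1: "1 \<le> N" using N by (cases N) auto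
  obtain p where p: "p \<in> \<C>" "wandering N p"
    and sweep: "partial_sup (\<lambda>i. (S ^^ i) p) (2 * N - 1) = e"
      "partial_sup (\<lambda>i. (inv S ^^ Suc i) p) (2 * N - 1) = e"
    using ex_sweeping_wandering[OF assms(7) N1] by blast
  interpret sweeping_component e T S p "2 * N - 1"
    by unfold_locales (fact p(1) sweep)+
  note G = automorphism_cyclic
  have "2 \<le> \<epsilon> * real N" using N assms(8) by (simp add: pos_divide_le_eq mult.commute)
  moreover have "0 \<le> T p" using T_nonneg component_nonneg[OF p(1)] by blast
  ultimately have "2 *\<^sub>R T p \<le> (\<epsilon> * real N) *\<^sub>R T p" by (rule scaleR_right_mono)
  also have "\<dots> = \<epsilon> *\<^sub>R (real N *\<^sub>R T p)" by simp
  also have "\<dots> \<le> \<epsilon> *\<^sub>R e"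
    using wandering_expectation_le[OF p] assms(8) by (intro scaleR_left_mono) simp_all
  finally have small: "2 *\<^sub>R T p \<le> \<epsilon> *\<^sub>R e" .
  have "T \<bar>S u - cyclic u\<bar> \<le> \<epsilon> *\<^sub>R e" if "u \<in> \<C>" for u
    using T_abs_diff_le[OF that] small by (rule order_trans)
  \<comment> \<open>The supremum is bounded termwise; the index set is nonempty because it contains
    \<open>0\<close>.\<close>
  then have "(SUP u\<in>\<C>. T \<bar>S u - cyclic u\<bar>) \<le> \<epsilon> *\<^sub>R e"
    using component_0 by (intro cSUP_least) auto
  moreover have "ceps T cyclic e"
    using T riesz_automorphism_homomorphism[OF G] riesz_automorphism_order_continuous[OF G]
      cyclic_unit T_cyclic by (simp add: ceps_def)
  moreover have "surj cyclic" using G by (simp add: riesz_automorphism_def bij_is_surj)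
  moreover have "ceps_periodic e cyclic e"
    using G cyclic_unit fact_ge_1 cyclic_funpow_fact by (rule finite_order_periodic)
  ultimately show ?thesis using riesz_automorphism_homomorphism[OF G] by blast
qed

end
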